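(* Let $E=B_p$ for some $1<p<\infty$ or $E=S_p$ for some $1\le p<\infty$, equipped with the unit vector basis $(e_n)_{n\in\mathbb{N}}$. The following conditions are equivalent for all infinite subsets $M,N$ of $\mathbb{N}$: (a) The Gasparis--Leung index $\Gamma\mathrm{L}_1(M,N)$ is finite. (b) The basic sequence $(e_m)_{m\in M}$ dominates $(e_n)_{n\in N}$. (c) There exists an operator $T\in\mathscr{B}(E_M,E_N)$ for which $\inf_{m\in M}\|Te_m\|_\infty>0$.
   Context: Scalars are $\mathbb{K}\in\{\mathbb{R},\mathbb{C}\}$ and $\mathbb{N}=\{1,2,3,\ldots\}$. The Schreier sets are $\mathcal{S}_1=\{F\subset\mathbb{N}\text{ finite} : |F|\le\min F\}$, with the convention $\min\emptyset=0$, so $\emptyset\in\mathcal{S}_1$. Let $c_{00}$ be the space of finitely supported elements of $\mathbb{K}^{\mathbb{N}}$. For $1\le p<\infty$, the $p$-th Schreier space $S_p$ is the completion of $c_{00}$ in the norm $\|x\|_{S_p}=\sup\{(\sum_{n\in F}|x(n)|^p)^{1/p} : F\in\mathcal{S}_1\setminus\{\emptyset\}\}$. For $1<p<\infty$, the $p$-th Baernstein space $B_p$ is the completion of $c_{00}$ in the norm $\|x\|_{B_p}=\sup\{(\sum_{j=1}^m(\sum_{n\in F_j}|x(n)|)^p)^{1/p} : m\in\mathbb{N},\ F_1,\ldots,F_m\in\mathcal{S}_1\setminus\{\emptyset\},\ \max F_j<\min F_{j+1}\text{ for }1\le j<m\}$. The unit vectors $(e_n)_{n\in\mathbb{N}}$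 form a normalized, $1$-unconditional basis for $E$ with coordinate functionals $e_n^*\in E^*$; for $x\in E$, $\|x\|_\infty=\sup_{n}|\langle x,e_n^*\rangle|$. For $N\subseteq\mathbb{N}$, $E_N=\overline{\operatorname{span}}(e_n : n\in N)$. $\mathscr{B}(X,Y)$ is the space of bounded linear maps $X\to Y$. Schreier covering number: for a finite set $A\subset\mathbb{N}$, $\tau_1(\emptyset)=0$ and, for $A\ne\emptyset$, $\tau_1(A)=\min\{m\in\mathbb{N} : A\subseteq\bigcup_{j=1}^mF_j\text{ for some non-empty }F_1,\ldots,F_m\in\mathcal{S}_1\text{ with }\max F_j<\min F_{j+1}\ (1\le j<m)\}$. For an infinite set $M=\{m_1<m_2<\cdots\}\subseteq\mathbb{N}$ and $J\subseteq\mathbb{N}$, $M(J)=\{m_j : j\in J\}$. For infinite $M,N\subseteq\mathbb{N}$, the Gasparis--Leung index of $M$ with respect to $N$ is $\Gamma\mathrm{L}_1(M,N)=\sup\{\tau_1(M(J)) : J\subset\mathbb{N}\text{ finite},\ N(J)\in\mathcal{S}_1\}\in\mathbb{N}\cup\{\infty\}$. A basic sequence $(x_n)_{n\in\mathbb{N}}$ in $X$ dominates a basic sequence $(y_n)_{n\in\mathbb{N}}$ in $Y$ if there is $C>0$ with $\|\sum_{n=1}^m\alpha_ny_n\|_Y\le C\|\sum_{n=1}^m\alpha_nx_n\|_X$ for all $m\in\mathbb{N}$ and $\alpha_1,\ldots,\alpha_m\in\mathbb{K}$. Sequences indexed by infinite sets $M,N\subseteq\mathbb{N}$ are enumerated increasingly.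 *)

theory Defs
  imports
    "HOL-Analysis.Analysis"
    "HOL-Library.Function_Algebras"
    "HOL-Library.Infinite_Set"
    "HOL-Library.Extended_Nat"
begin

text \<open>
  Conventions. The positive integers are \<open>{1..} :: nat set\<close>; an element of \<open>K\<^sup>N\<close> is a function
  \<open>x :: nat \<Rightarrow> 'k\<close> with \<open>x 0 = 0\<close>. The scalar field is a type of class
  \<open>{real_normed_field, euclidean_space}\<close>: by Frobenius' theorem and uniqueness of the multiplicative
  norm such a type is isometrically isomorphic to the real or the complex numbers, and both are
  instances.

  The norms are defined for all scalar sequences, with values in \<open>ennreal\<close>. The completion of the
  finitely supported sequences is realised as their closure inside the sequences with
  \<open>x 0 = 0\<close>; the last section proves that for the norms in question this closure is a complete
  metric space in which the finitely supported sequences are dense. The coordinate functionals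
  are then evaluation at a point, so that \<open>sup_norm x\<close> is the supremum of their moduli at \<open>x\<close>.
\<close>

section \<open>Schreier sets\<close>

definition schreier_sets :: "nat set set" where
  "schreier_sets = {F. finite F \<and> F \<subseteq> {1..} \<and> (F = {} \<or> card F \<le> Min F)}"

definition schreier_chain :: "nat \<Rightarrow> (nat \<Rightarrow> nat set) \<Rightarrow> bool" where
  "schreier_chain m F \<longleftrightarrow>
     (\<forall>j\<in>{1..m}. F j \<in> schreier_sets - {{}}) \<and>
     (\<forall>j. 1 \<le> j \<and> j < m \<longrightarrow> Max (F j) < Min (F (j + 1)))"

definition schreier_covering_number :: "nat set \<Rightarrow> nat" where
  "schreier_covering_number A =
     (if A = {} then 0
      else (LEAST m. 1 \<le> m \<and> (\<exists>F. schreier_chain m F \<and> A \<subseteq> (\<Union>j\<in>{1..m}. F j))))"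

text \<open>The library's \<open>enumerate\<close> starts at index 0; here \<open>m\<^sub>1 < m\<^sub>2 < \<dots>\<close> starts at index 1.\<close>

definition nth_element :: "nat set \<Rightarrow> nat \<Rightarrow> nat" where
  "nth_element M j = enumerate M (j - 1)"

definition gasparis_leung_index :: "nat set \<Rightarrow> nat set \<Rightarrow> enat" where
  "gasparis_leung_index M N =
     (SUP J\<in>{J. finite J \<and> J \<subseteq> {1..} \<and> nth_element N ` J \<in> schreier_sets}.
        enat (schreier_covering_number (nth_element M ` J)))"

section \<open>Schreier and Baernstein spaces\<close>

definition schreier_norm :: "real \<Rightarrow> (nat \<Rightarrow> 'k::{real_normed_field, euclidean_space}) \<Rightarrow> ennreal" where
  "schreier_norm p x =
     (SUP F\<in>schreier_sets - {{}}. ennreal ((\<Sum>n\<in>F. norm (x n) powr p) powr (1 / p)))"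

definition baernstein_norm :: "real \<Rightarrow> (nat \<Rightarrow> 'k::{real_normed_field, euclidean_space}) \<Rightarrow> ennreal" where
  "baernstein_norm p x =
     (SUP (m, F)\<in>{(m, F). 1 \<le> m \<and> schreier_chain m F}.
        ennreal ((\<Sum>j=1..m. (\<Sum>n\<in>F j. norm (x n)) powr p) powr (1 / p)))"

definition sup_norm :: "(nat \<Rightarrow> 'k::{real_normed_field, euclidean_space}) \<Rightarrow> ennreal" where
  "sup_norm x = (SUP n\<in>{1..}. ennreal (norm (x n)))"

definition c00 :: "(nat \<Rightarrow> 'k::{real_normed_field, euclidean_space}) set" where
  "c00 = {x. x 0 = 0 \<and> finite {n. x n \<noteq> 0}}"

definition unit_vector :: "nat \<Rightarrow> nat \<Rightarrow> 'k::{real_normed_field, euclidean_space}" where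
  "unit_vector m = (\<lambda>n. if n = m then 1 else 0)"

definition seq_scale :: "'k \<Rightarrow> (nat \<Rightarrow> 'k) \<Rightarrow> nat \<Rightarrow> 'k::{real_normed_field, euclidean_space}"
    (infixr "*\<^sub>s" 75) where
  "c *\<^sub>s x = (\<lambda>n. c * x n)"

definition seq_closure ::
    "((nat \<Rightarrow> 'k::{real_normed_field, euclidean_space}) \<Rightarrow> ennreal) \<Rightarrow> (nat \<Rightarrow> 'k) set \<Rightarrow> (nat \<Rightarrow> 'k) set" where
  "seq_closure nrm A = {x. x 0 = 0 \<and> (\<forall>\<epsilon>>0. \<exists>y\<in>A. nrm (x - y) < ennreal \<epsilon>)}"

definition c00_completion ::
    "((nat \<Rightarrow> 'k::{real_normed_field, euclidean_space}) \<Rightarrow> ennreal) \<Rightarrow> (nat \<Rightarrow> 'k) set" where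
  "c00_completion nrm = seq_closure nrm c00"

definition closed_span ::
    "((nat \<Rightarrow> 'k::{real_normed_field, euclidean_space}) \<Rightarrow> ennreal) \<Rightarrow> nat set \<Rightarrow> (nat \<Rightarrow> 'k) set" where
  "closed_span nrm N = {x \<in> c00_completion nrm.
     \<forall>\<epsilon>>0. \<exists>y\<in>module.span seq_scale (unit_vector ` N). nrm (x - y) < ennreal \<epsilon>}"

section \<open>Operators and domination\<close>

text \<open>Only the restriction of \<open>T\<close> to the domain \<open>X\<close> is meaningful.\<close>

definition bounded_operators ::
    "((nat \<Rightarrow> 'k::{real_normed_field, euclidean_space}) \<Rightarrow> ennreal) \<Rightarrow> (nat \<Rightarrow> 'k) set \<Rightarrow> (nat \<Rightarrow> 'k) set
      \<Rightarrow> ((nat \<Rightarrow> 'k) \<Rightarrow> nat \<Rightarrow> 'k) set" where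
  "bounded_operators nrm X Y = {T.
     (\<forall>x\<in>X. T x \<in> Y) \<and>
     (\<forall>x\<in>X. \<forall>y\<in>X. T (x + y) = T x + T y) \<and>
     (\<forall>c. \<forall>x\<in>X. T (c *\<^sub>s x) = c *\<^sub>s T x) \<and>
     (\<exists>C::real. \<forall>x\<in>X. nrm (T x) \<le> ennreal C * nrm x)}"

text \<open>The sequences \<open>x\<close> and \<open>y\<close> are indexed from 1.\<close>

definition dominates ::
    "((nat \<Rightarrow> 'k::{real_normed_field, euclidean_space}) \<Rightarrow> ennreal) \<Rightarrow> (nat \<Rightarrow> nat \<Rightarrow> 'k)
      \<Rightarrow> ((nat \<Rightarrow> 'k) \<Rightarrow> ennreal) \<Rightarrow> (nat \<Rightarrow> nat \<Rightarrow> 'k) \<Rightarrow> bool" where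
  "dominates nrmX x nrmY y \<longleftrightarrow>
     (\<exists>C>0. \<forall>m\<ge>1. \<forall>\<alpha>::nat \<Rightarrow> 'k.
        nrmY (\<Sum>n=1..m. \<alpha> n *\<^sub>s y n) \<le> ennreal C * nrmX (\<Sum>n=1..m. \<alpha> n *\<^sub>s x n))"

section \<open>Justification of the model of the completion\<close>

lemma module_seq_scale: "module seq_scale"
  by unfold_locales (auto simp: seq_scale_def fun_eq_iff algebra_simps)

locale coordinate_norm =
  fixes nrm :: "(nat \<Rightarrow> 'k::{real_normed_field, euclidean_space}) \<Rightarrow> ennreal"
  assumes scale: "nrm (c *\<^sub>s x) = ennreal (norm c) * nrm x"
    and triangle: "nrm (x + y) \<le> nrm x + nrm y"
    and coordinate_le: "1 \<le> n \<Longrightarrow> ennreal (norm (x n)) \<le> nrm x"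
    and unit_vector_le: "nrm (unit_vector n) \<le> 1"
    and fatou: "(\<And>n. (\<lambda>k. X k n) \<longlonglongrightarrow> x n) \<Longrightarrow> (\<And>k. nrm (X k) \<le> C) \<Longrightarrow> nrm x \<le> C"
begin

lemma nrm_zero [simp]: "nrm 0 = 0"
  using scale[of 0 0] by (simp add: seq_scale_def zero_fun_def)

lemma nrm_minus: "nrm (x - y) = nrm (y - x)"
proof -
  have "x - y = (- 1) *\<^sub>s (y - x)"
    by (simp add: seq_scale_def fun_eq_iff)
  then show ?thesis
    by (metis scale norm_minus_cancel norm_one ennreal_1 mult_1)
qed

lemma triangle3: "nrm (x - z) \<le> nrm (x - y) + nrm (y - z)"
  using triangle[of "x - y" "y - z"] by simp

lemma nrm_sum_finite: "finite A \<Longrightarrow> (\<And>a. a \<in> A \<Longrightarrow> nrm (f a) < \<infinity>) \<Longrightarrow> nrm (sum f A) < \<infinity>"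
  by (induction A rule: finite_induct)
     (auto intro!: order.strict_trans1[OF triangle] simp: top.not_eq_extremum)

lemma nrm_c00_finite:
  assumes "x \<in> c00" shows "nrm x < \<infinity>"
proof -
  have fin: "finite {n. x n \<noteq> 0}"
    using assms by (simp add: c00_def)
  have "x = (\<Sum>n | x n \<noteq> 0. x n *\<^sub>s unit_vector n)"
  proof
    fix k
    have "(\<Sum>n | x n \<noteq> 0. x n *\<^sub>s unit_vector n) k = (\<Sum>n | x n \<noteq> 0. (x n *\<^sub>s unit_vector n) k)"
      using fin by (induction rule: finite_induct) auto
    also have "\<dots> = (\<Sum>n | x n \<noteq> 0. if n = k then x n else 0)"
      by (rule sum.cong) (auto simp: seq_scale_def unit_vector_def)
    also have "\<dots> = x k"
      using fin by simp
    finally show "x k = (\<Sum>n | x n \<noteq> 0. x n *\<^sub>s unit_vector n) k" ..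
  qed
  moreover have "nrm (\<Sum>n | x n \<noteq> 0. x n *\<^sub>s unit_vector n) < \<infinity>"
  proof (rule nrm_sum_finite[OF fin])
    fix n
    have "nrm (unit_vector n) < \<infinity>"
      using order.strict_trans1[OF unit_vector_le[of n]] by simp
    then show "nrm (x n *\<^sub>s unit_vector n) < \<infinity>"
      by (simp add: scale ennreal_mult_less_top)
  qed
  ultimately show ?thesis
    by simp
qed

lemma completion_zero_coord: "x \<in> c00_completion nrm \<Longrightarrow> x 0 = 0"
  by (simp add: c00_completion_def seq_closure_def)

lemma c00_subset_completion: "c00 \<subseteq> c00_completion nrm"
proof
  fix x :: "nat \<Rightarrow> 'k" assume x: "x \<in> c00"
  then have "nrm (x - x) < ennreal \<epsilon>" if "\<epsilon> > 0" for \<epsilon>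
    using that by simp
  with x show "x \<in> c00_completion nrm"
    by (auto simp: c00_completion_def seq_closure_def c00_def simp del: cancel_comm_monoid_add_class.diff_cancel)
qed

lemma completion_finite:
  assumes "x \<in> c00_completion nrm" shows "nrm x < \<infinity>"
proof -
  from assms obtain y where y: "y \<in> c00" "nrm (x - y) < ennreal 1"
    unfolding c00_completion_def seq_closure_def using zero_less_one by blast
  have "nrm x \<le> nrm (x - y) + nrm y"
    using triangle[of "x - y" y] by simp
  also have "\<dots> < \<infinity>"
    using y nrm_c00_finite[OF y(1)] by (auto intro: order.strict_trans)
  finally show ?thesis .
qed

lemma completion_diff_finite:
  assumes "x \<in> c00_completion nrm" "y \<in> c00_completion nrm" shows "nrm (x - y) < \<infinity>"
  using triangle3[of x y 0] completion_finite[OF assms(1)] completion_finite[OF assms(2)]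
    nrm_minus[of 0 y]
  by (simp add: order.strict_trans1)

definition completion_dist :: "(nat \<Rightarrow> 'k) \<Rightarrow> (nat \<Rightarrow> 'k) \<Rightarrow> real" where
  "completion_dist x y = enn2real (nrm (x - y))"

lemma completion_dist_ennreal:
  "x \<in> c00_completion nrm \<Longrightarrow> y \<in> c00_completion nrm \<Longrightarrow> ennreal (completion_dist x y) = nrm (x - y)"
  using completion_diff_finite by (simp add: completion_dist_def less_top)

lemma completion_dist_less:
  "x \<in> c00_completion nrm \<Longrightarrow> y \<in> c00_completion nrm \<Longrightarrow> \<epsilon> > 0 \<Longrightarrow>
     completion_dist x y < \<epsilon> \<longleftrightarrow> nrm (x - y) < ennreal \<epsilon>"
  by (metis completion_dist_ennreal completion_dist_def enn2real_nonneg ennreal_less_iff)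

sublocale completion: Metric_space "c00_completion nrm" completion_dist
proof
  fix x y z
  show nonneg: "0 \<le> completion_dist x y" for x y
    by (simp add: completion_dist_def)
  show "completion_dist x y = completion_dist y x"
    by (simp add: completion_dist_def nrm_minus)
  assume x: "x \<in> c00_completion nrm" and y: "y \<in> c00_completion nrm"
  have "x = y" if "nrm (x - y) = 0"
  proof
    fix n
    have "norm (x n - y n) = 0" if "1 \<le> n"
      using coordinate_le[OF that, of "x - y"] \<open>nrm (x - y) = 0\<close> by simp
    then show "x n = y n"
      using completion_zero_coord[OF x] completion_zero_coord[OF y] by (cases n) auto
  qed
  then show "completion_dist x y = 0 \<longleftrightarrow> x = y"
    using completion_dist_ennreal[OF x y] by (auto simp: completion_dist_def)
  assume z: "z \<in> c00_completion nrm"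
  have "ennreal (completion_dist x z) \<le> ennreal (completion_dist x y + completion_dist y z)"
    using triangle3[of x z y] completion_dist_ennreal[OF x y] completion_dist_ennreal[OF x z]
      completion_dist_ennreal[OF y z]
    by (simp add: ennreal_plus nonneg)
  then show "completion_dist x z \<le> completion_dist x y + completion_dist y z"
    using ennreal_le_iff nonneg by (metis add_nonneg_nonneg)
qed

theorem completion_mcomplete: "completion.mcomplete"
  unfolding completion.mcomplete_def
proof (intro allI impI)
  fix X assume "completion.MCauchy X"
  then have X: "\<And>k. X k \<in> c00_completion nrm"
    and Cau: "\<And>\<epsilon>. \<epsilon> > 0 \<Longrightarrow> \<exists>K. \<forall>k\<ge>K. \<forall>l\<ge>K. completion_dist (X k) (X l) < \<epsilon>"
    by (simp_all add: completion.MCauchy_def image_subset_iff)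
  have "Cauchy (\<lambda>k. X k n)" for n
  proof (cases "n = 0")
    case True
    then show ?thesis
      using completion_zero_coord[OF X] by (simp add: Cauchy_def)
  next
    case False
    have "norm (X k n - X l n) \<le> completion_dist (X k) (X l)" for k l
    proof -
      have "ennreal (norm (X k n - X l n)) \<le> ennreal (completion_dist (X k) (X l))"
        using coordinate_le[of n "X k - X l"] False completion_dist_ennreal[OF X X] by simp
      then show ?thesis
        by (simp add: completion_dist_def)
    qed
    then show ?thesis
      unfolding Cauchy_def dist_norm using Cau by (meson le_less_trans)
  qed
  then have "\<forall>n. \<exists>l. (\<lambda>k. X k n) \<longlonglongrightarrow> l"
    using Cauchy_convergent unfolding convergent_def by blast
  then obtain x where x: "\<And>n. (\<lambda>k. X k n) \<longlonglongrightarrow> x n"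
    by metis
  have lim: "\<exists>K. \<forall>k\<ge>K. nrm (X k - x) < ennreal \<epsilon>" if eps: "\<epsilon> > 0" for \<epsilon> :: real
  proof -
    obtain K where K: "\<And>k l. k \<ge> K \<Longrightarrow> l \<ge> K \<Longrightarrow> completion_dist (X k) (X l) < \<epsilon> / 2"
      using Cau[OF half_gt_zero[OF eps]] by blast
    have "nrm (X k - x) \<le> ennreal (\<epsilon> / 2)" if "k \<ge> K" for k
    proof (rule fatou)
      show "(\<lambda>l. (X k - X (l + K)) n) \<longlonglongrightarrow> (X k - x) n" for n
        using LIMSEQ_ignore_initial_segment[OF x[of n], of K] by (auto intro: tendsto_diff)
      show "nrm (X k - X (l + K)) \<le> ennreal (\<epsilon> / 2)" for l
        using K[of k "l + K"] that by (simp flip: completion_dist_ennreal[OF X X] add: ennreal_leI)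
    qed
    moreover have "ennreal (\<epsilon> / 2) < ennreal \<epsilon>"
      using eps by (simp add: ennreal_less_iff)
    ultimately show ?thesis
      by (meson le_less_trans)
  qed
  have xE: "x \<in> c00_completion nrm"
    unfolding c00_completion_def seq_closure_def
  proof (intro CollectI conjI allI impI)
    show "x 0 = 0"
      using x[of 0] completion_zero_coord[OF X] by (simp add: LIMSEQ_const_iff)
    fix \<epsilon> :: real assume e: "0 < \<epsilon>"
    obtain k where k: "nrm (X k - x) < ennreal (\<epsilon> / 2)"
      using lim[of "\<epsilon> / 2"] e by auto
    obtain y where y: "y \<in> c00" "nrm (X k - y) < ennreal (\<epsilon> / 2)"
      using X[of k] half_gt_zero[OF e] unfolding c00_completion_def seq_closure_def by blast
    have "nrm (x - y) \<le> nrm (X k - x) + nrm (X k - y)"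
      using triangle3[of x y "X k"] nrm_minus[of x] by simp
    also have "\<dots> < ennreal (\<epsilon> / 2) + ennreal (\<epsilon> / 2)"
      using k y(2) by (rule add_strict_mono)
    also have "\<dots> = ennreal \<epsilon>"
      using e by (simp flip: ennreal_plus)
    finally show "\<exists>y\<in>c00. nrm (x - y) < ennreal \<epsilon>"
      using y(1) by blast
  qed
  have "limitin completion.mtopology X x sequentially"
    unfolding completion.limit_metric_sequentially
    using xE X lim by (auto simp: completion_dist_less[OF X xE])
  then show "\<exists>x. limitin completion.mtopology X x sequentially"
    by blast
qed

theorem completion_closure_of:
  assumes "A \<subseteq> c00_completion nrm"
  shows "completion.mtopology closure_of A =
           {x \<in> c00_completion nrm. \<forall>\<epsilon>>0. \<exists>y\<in>A. nrm (x - y) < ennreal \<epsilon>}"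
  unfolding completion.metric_closure_of completion.in_mball
  using assms completion_dist_less by blast

lemma span_unit_vectors_subset_c00:
  assumes "N \<subseteq> {1..}"
  shows "module.span seq_scale (unit_vector ` N) \<subseteq> (c00 :: (nat \<Rightarrow> 'k) set)"
proof (rule module.span_minimal[OF module_seq_scale])
  show "unit_vector ` N \<subseteq> (c00 :: (nat \<Rightarrow> 'k) set)"
    using assms by (auto simp: c00_def unit_vector_def)
  show "module.subspace seq_scale (c00 :: (nat \<Rightarrow> 'k) set)"
  proof (rule module.subspaceI[OF module_seq_scale])
    fix c :: 'k and x y :: "nat \<Rightarrow> 'k"
    show "(0 :: nat \<Rightarrow> 'k) \<in> c00"
      by (simp add: c00_def)
    assume x: "x \<in> c00"
    then show "c *\<^sub>s x \<in> c00"
      by (auto simp: c00_def seq_scale_def)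
    assume "y \<in> c00"
    with x have "finite ({n. x n \<noteq> 0} \<union> {n. y n \<noteq> 0})" "x 0 + y 0 = 0"
      by (auto simp: c00_def)
    moreover have "{n. x n + y n \<noteq> 0} \<subseteq> {n. x n \<noteq> 0} \<union> {n. y n \<noteq> 0}"
      by auto
    ultimately have "finite {n. x n + y n \<noteq> 0}" "x 0 + y 0 = 0"
      by (blast intro: finite_subset)+
    then show "x + y \<in> c00"
      by (simp add: c00_def)
  qed
qed

theorem closed_span_eq_closure_of:
  assumes "N \<subseteq> {1..}"
  shows "closed_span nrm N = completion.mtopology closure_of module.span seq_scale (unit_vector ` N)"
  unfolding closed_span_def
  by (rule completion_closure_of[symmetric])
     (rule order_trans[OF span_unit_vectors_subset_c00[OF assms] c00_subset_completion])

theorem c00_dense: "completion.mtopology closure_of c00 = c00_completion nrm"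
  unfolding completion_closure_of[OF c00_subset_completion]
  by (auto simp: c00_completion_def seq_closure_def)

end

lemma coordinate_norm_SUP:
  fixes q :: "'i \<Rightarrow> (nat \<Rightarrow> 'k::{real_normed_field, euclidean_space}) \<Rightarrow> real"
  assumes nrm: "\<And>x. nrm x = (SUP i\<in>I. ennreal (q i x))"
    and nonneg: "\<And>i x. i \<in> I \<Longrightarrow> 0 \<le> q i x"
    and scale: "\<And>i c x. i \<in> I \<Longrightarrow> q i (c *\<^sub>s x) = norm c * q i x"
    and triangle: "\<And>i x y. i \<in> I \<Longrightarrow> q i (x + y) \<le> q i x + q i y"
    and coordinate: "\<And>n x. 1 \<le> n \<Longrightarrow> \<exists>i\<in>I. norm (x n) \<le> q i x"
    and unit_vector: "\<And>i n. i \<in> I \<Longrightarrow> q i (unit_vector n) \<le> 1"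
    and tendsto: "\<And>i X x. i \<in> I \<Longrightarrow> (\<And>n. (\<lambda>k::nat. X k n) \<longlonglongrightarrow> x n) \<Longrightarrow> (\<lambda>k. q i (X k)) \<longlonglongrightarrow> q i x"
  shows "coordinate_norm nrm"
proof
  show "nrm (c *\<^sub>s x) = ennreal (norm c) * nrm x" for c x
    unfolding nrm SUP_mult_left_ennreal by (rule SUP_cong) (auto simp: scale ennreal_mult nonneg)
  show "nrm (x + y) \<le> nrm x + nrm y" for x y
  proof (subst nrm, rule SUP_least)
    fix i assume i: "i \<in> I"
    have "ennreal (q i (x + y)) \<le> ennreal (q i x) + ennreal (q i y)"
      using triangle[OF i] nonneg[OF i] by (simp add: ennreal_leI flip: ennreal_plus)
    also have "\<dots> \<le> nrm x + nrm y"
      unfolding nrm using i by (intro add_mono SUP_upper)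
    finally show "ennreal (q i (x + y)) \<le> nrm x + nrm y" .
  qed
  show "ennreal (norm (x n)) \<le> nrm x" if "1 \<le> n" for n x
    unfolding nrm using coordinate[OF that] by (meson SUP_upper2 ennreal_leI)
  show "nrm (unit_vector n) \<le> 1" for n
    unfolding nrm using unit_vector by (auto intro!: SUP_least)
  show "nrm x \<le> C" if X: "\<And>n. (\<lambda>k. X k n) \<longlonglongrightarrow> x n" and C: "\<And>k. nrm (X k) \<le> C" for X x C
  proof (subst nrm, rule SUP_least)
    fix i assume i: "i \<in> I"
    have "ennreal (q i (X k)) \<le> C" for k
      using order_trans[OF SUP_upper[OF i, of "\<lambda>i. ennreal (q i (X k))"] C[of k, unfolded nrm]] .
    then show "ennreal (q i x) \<le> C"
      by (intro LIMSEQ_le_const2[OF tendsto_ennrealI[OF tendsto[OF i X]]]) auto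
  qed
qed

lemma powr_convex_combination:
  fixes p t u v :: real
  assumes "1 \<le> p" "0 \<le> t" "t \<le> 1" "0 \<le> u" "0 \<le> v"
  shows "(t * u + (1 - t) * v) powr p \<le> t * u powr p + (1 - t) * v powr p"
proof -
  have le: "(s * w) powr p \<le> s * w powr p" if "0 \<le> s" "s \<le> 1" "0 \<le> w" for s w :: real
    using powr_mono'[of 1 p s] that \<open>1 \<le> p\<close> by (simp add: powr_mult mult_right_mono)
  consider "u = 0" | "v = 0" | "u > 0" "v > 0"
    using assms by linarith
  then show ?thesis
  proof cases
    case 3
    then show ?thesis
      using convex_onD[OF powr_convex[OF \<open>1 \<le> p\<close>], of "1 - t" u v] assms by simp
  qed (use le[of t u] le[of "1 - t" v] assms in auto)
qed

lemma minkowski_powr: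
  fixes a b :: "'i \<Rightarrow> real"
  assumes p: "1 \<le> p" and a: "\<And>i. i \<in> A \<Longrightarrow> 0 \<le> a i" and b: "\<And>i. i \<in> A \<Longrightarrow> 0 \<le> b i"
  shows "(\<Sum>i\<in>A. (a i + b i) powr p) powr (1 / p)
           \<le> (\<Sum>i\<in>A. a i powr p) powr (1 / p) + (\<Sum>i\<in>A. b i powr p) powr (1 / p)"
    (is "_ \<le> ?\<alpha> + ?\<beta>")
proof (cases "finite A \<and> (\<Sum>i\<in>A. a i powr p) > 0 \<and> (\<Sum>i\<in>A. b i powr p) > 0")
  case False
  have "0 \<le> (\<Sum>i\<in>A. a i powr p)" "0 \<le> (\<Sum>i\<in>A. b i powr p)"
    by (simp_all add: sum_nonneg)
  with False consider "infinite A"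
    | "finite A" "(\<Sum>i\<in>A. a i powr p) = 0" | "finite A" "(\<Sum>i\<in>A. b i powr p) = 0"
    by linarith
  then show ?thesis
  proof cases
    case 2
    then have "\<forall>i\<in>A. a i = 0"
      by (simp add: sum_nonneg_eq_0_iff)
    then show ?thesis by simp
  next
    case 3
    then have "\<forall>i\<in>A. b i = 0"
      by (simp add: sum_nonneg_eq_0_iff)
    then show ?thesis by simp
  qed simp
next
  case True
  define \<alpha> \<beta> where "\<alpha> = ?\<alpha>" and "\<beta> = ?\<beta>"
  have pos: "\<alpha> > 0" "\<beta> > 0"
    using True by (auto simp: \<alpha>_def \<beta>_def)
  have sums: "\<alpha> powr p = (\<Sum>i\<in>A. a i powr p)" "\<beta> powr p = (\<Sum>i\<in>A. b i powr p)"
    using True p by (simp_all add: \<alpha>_def \<beta>_def powr_powr)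
  define t where "t = \<alpha> / (\<alpha> + \<beta>)"
  have t: "0 \<le> t" "t \<le> 1" and t1: "1 - t = \<beta> / (\<alpha> + \<beta>)"
    using pos by (auto simp: t_def field_simps)
  have "(a i + b i) powr p
          \<le> (\<alpha> + \<beta>) powr p * (t * (a i powr p / \<alpha> powr p) + (1 - t) * (b i powr p / \<beta> powr p))"
    if i: "i \<in> A" for i
  proof -
    have "(a i + b i) powr p = ((\<alpha> + \<beta>) * (t * (a i / \<alpha>) + (1 - t) * (b i / \<beta>))) powr p"
      unfolding t1 unfolding t_def using pos by (simp add: distrib_left)
    also have "\<dots> = (\<alpha> + \<beta>) powr p * (t * (a i / \<alpha>) + (1 - t) * (b i / \<beta>)) powr p"
      by (rule powr_mult)
    also have "\<dots> \<le> (\<alpha> + \<beta>) powr p * (t * (a i / \<alpha>) powr p + (1 - t) * (b i / \<beta>) powr p)"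
      using pos t p a[OF i] b[OF i] by (intro mult_left_mono powr_convex_combination) auto
    finally show ?thesis
      using pos a[OF i] b[OF i] by (simp add: powr_divide)
  qed
  then have "(\<Sum>i\<in>A. (a i + b i) powr p) \<le>
      (\<Sum>i\<in>A. (\<alpha> + \<beta>) powr p * (t * (a i powr p / \<alpha> powr p) + (1 - t) * (b i powr p / \<beta> powr p)))"
    by (rule sum_mono)
  also have "\<dots> = (\<alpha> + \<beta>) powr p *
      (t * ((\<Sum>i\<in>A. a i powr p) / \<alpha> powr p) + (1 - t) * ((\<Sum>i\<in>A. b i powr p) / \<beta> powr p))"
    by (simp add: sum.distrib flip: sum_distrib_left sum_divide_distrib)
  also have "\<dots> = (\<alpha> + \<beta>) powr p"
    unfolding sums[symmetric] using pos by simp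
  finally have "(\<Sum>i\<in>A. (a i + b i) powr p) powr (1 / p) \<le> ((\<alpha> + \<beta>) powr p) powr (1 / p)"
    using p by (intro powr_mono2) (auto intro: sum_nonneg)
  then show ?thesis
    using pos p by (simp add: powr_powr \<alpha>_def \<beta>_def)
qed

lemma tendsto_powr_nonneg:
  fixes f :: "nat \<Rightarrow> real"
  assumes "f \<longlonglongrightarrow> l" "0 < r" "\<And>k. 0 \<le> f k"
  shows "(\<lambda>k. f k powr r) \<longlonglongrightarrow> l powr r"
  using assms by (intro tendsto_powr') auto

lemma singleton_schreier: "1 \<le> n \<Longrightarrow> {n} \<in> schreier_sets"
  by (simp add: schreier_sets_def)

theorem coordinate_norm_schreier_norm:
  fixes p :: real
  assumes p: "1 \<le> p"
  shows "coordinate_norm (schreier_norm p :: (nat \<Rightarrow> 'k::{real_normed_field, euclidean_space}) \<Rightarrow> _)"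
proof (rule coordinate_norm_SUP[OF schreier_norm_def])
  fix F n and c :: 'k and x y :: "nat \<Rightarrow> 'k" and X :: "nat \<Rightarrow> nat \<Rightarrow> 'k"
  let ?q = "\<lambda>x::nat \<Rightarrow> 'k. (\<Sum>n\<in>F. norm (x n) powr p) powr (1 / p)"
  show "0 \<le> ?q x" by simp
  show "?q (c *\<^sub>s x) = norm c * ?q x"
    using p by (simp add: seq_scale_def norm_mult powr_mult sum_nonneg powr_powr flip: sum_distrib_left)
  have "?q (x + y) \<le> (\<Sum>n\<in>F. (norm (x n) + norm (y n)) powr p) powr (1 / p)"
    using p by (intro powr_mono2 sum_mono sum_nonneg) (auto intro: norm_triangle_ineq)
  also have "\<dots> \<le> ?q x + ?q y"
    by (intro minkowski_powr p norm_ge_zero)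
  finally show "?q (x + y) \<le> ?q x + ?q y" .
  show "?q (unit_vector n) \<le> 1"
  proof -
    have "(\<Sum>i\<in>F. norm (unit_vector n i :: 'k) powr p) = (\<Sum>i\<in>F. if i = n then 1 else 0)"
      by (rule sum.cong) (auto simp: unit_vector_def)
    also have "\<dots> \<le> 1"
      by (cases "finite F") auto
    finally show ?thesis
      using p by (intro powr_le1) (simp_all add: abs_of_nonneg sum_nonneg)
  qed
  show "(\<lambda>k. ?q (X k)) \<longlonglongrightarrow> ?q x" if "\<And>n::nat. (\<lambda>k. X k n) \<longlonglongrightarrow> x n"
    using p that by (intro tendsto_powr_nonneg tendsto_sum tendsto_norm sum_nonneg) auto
next
  fix n :: nat and x :: "nat \<Rightarrow> 'k" assume "1 \<le> n"
  then show "\<exists>F\<in>schreier_sets - {{}}. norm (x n) \<le> (\<Sum>n\<in>F. norm (x n) powr p) powr (1 / p)"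
    using p singleton_schreier by (intro bexI[of _ "{n}"]) (auto simp: powr_powr)
qed

lemma schreier_chain_less:
  assumes "schreier_chain m F" "i < j" "1 \<le> i" "j \<le> m"
  shows "Max (F i) < Min (F j)"
  using assms(2-)
proof (induction j rule: less_induct)
  case (less j)
  have step: "Max (F (j - 1)) < Min (F j)"
    using assms(1) less.prems by (auto simp: schreier_chain_def dest!: spec[of _ "j - 1"])
  show ?case
  proof (cases "i = j - 1")
    case False
    then have "Max (F i) < Min (F (j - 1))"
      using less by auto
    moreover have "Min (F (j - 1)) \<le> Max (F (j - 1))"
    proof -
      have "j - 1 \<in> {1..m}" using less.prems by auto
      then have "finite (F (j - 1))" "F (j - 1) \<noteq> {}"
        using assms(1) by (auto simp: schreier_chain_def schreier_sets_def)
      then show ?thesis by simp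
    qed
    ultimately show ?thesis using step by simp
  qed (use step in simp)
qed

lemma schreier_chain_disjoint:
  assumes "schreier_chain m F" "i \<in> {1..m}" "j \<in> {1..m}" "n \<in> F i" "n \<in> F j"
  shows "i = j"
proof (rule ccontr)
  have fin: "finite (F k)" if "k \<in> {1..m}" for k
    using assms(1) that by (auto simp: schreier_chain_def schreier_sets_def)
  assume "i \<noteq> j"
  then consider "i < j" | "j < i" by linarith
  then show False
  proof cases
    case 1
    then show False
      using schreier_chain_less[OF assms(1), of i j] Max_ge[OF fin assms(4)] Min_le[OF fin assms(5)] assms(2,3)
      by simp
  next
    case 2
    then show False
      using schreier_chain_less[OF assms(1), of j i] Max_ge[OF fin assms(5)] Min_le[OF fin assms(4)] assms(2,3)
      by simp
  qed
qed

theorem coordinate_norm_baernstein_norm: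
  fixes p :: real
  assumes p: "1 < p"
  shows "coordinate_norm (baernstein_norm p :: (nat \<Rightarrow> 'k::{real_normed_field, euclidean_space}) \<Rightarrow> _)"
proof (rule coordinate_norm_SUP)
  define q :: "nat \<times> (nat \<Rightarrow> nat set) \<Rightarrow> (nat \<Rightarrow> 'k) \<Rightarrow> real" where
    "q = (\<lambda>(m, F) x. (\<Sum>j=1..m. (\<Sum>n\<in>F j. norm (x n)) powr p) powr (1 / p))"
  let ?I = "{(m, F). 1 \<le> m \<and> schreier_chain m F}"
  show "baernstein_norm p x = (SUP i\<in>?I. ennreal (q i x))" for x :: "nat \<Rightarrow> 'k"
    unfolding baernstein_norm_def by (rule SUP_cong) (auto simp: q_def)
  fix i n and c :: 'k and x y :: "nat \<Rightarrow> 'k" and X :: "nat \<Rightarrow> nat \<Rightarrow> 'k"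
  show "\<exists>i\<in>?I. norm (x n) \<le> q i x" if "1 \<le> n"
    using p that singleton_schreier[of n]
    by (intro bexI[of _ "(1, \<lambda>_. {n})"]) (auto simp: q_def powr_powr schreier_chain_def)
  assume "i \<in> ?I"
  then obtain m F where i: "i = (m, F)" and F: "schreier_chain m F"
    by blast
  show "0 \<le> q i x"
    by (simp add: i q_def)
  show "q i (c *\<^sub>s x) = norm c * q i x"
    using p by (simp add: i q_def seq_scale_def norm_mult powr_mult sum_nonneg powr_powr flip: sum_distrib_left)
  have "q i (x + y) \<le> (\<Sum>j=1..m. ((\<Sum>n\<in>F j. norm (x n)) + (\<Sum>n\<in>F j. norm (y n))) powr p) powr (1 / p)"
    using p unfolding i q_def prod.case
    by (intro powr_mono2 sum_mono sum_nonneg)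
       (auto simp: sum_nonneg simp flip: sum.distrib intro!: sum_mono norm_triangle_ineq)
  also have "\<dots> \<le> q i x + q i y"
    using p unfolding i q_def prod.case by (intro minkowski_powr sum_nonneg) auto
  finally show "q i (x + y) \<le> q i x + q i y" .
  show "q i (unit_vector n) \<le> 1"
  proof -
    let ?J = "{j\<in>{1..m}. n \<in> F j}"
    have "card ?J \<le> 1"
      using schreier_chain_disjoint[OF F] by (auto simp: card_le_Suc0_iff_eq)
    have "(\<Sum>n'\<in>F j. norm (unit_vector n n' :: 'k)) = (if n \<in> F j then 1 else 0)" if "j \<in> {1..m}" for j
    proof -
      have "finite (F j)"
        using F that by (auto simp: schreier_chain_def schreier_sets_def)
      then show ?thesis
        by (simp add: unit_vector_def if_distrib[of norm] cong: if_cong)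
    qed
    then have "(\<Sum>j=1..m. (\<Sum>n'\<in>F j. norm (unit_vector n n' :: 'k)) powr p)
        = (\<Sum>j=1..m. if n \<in> F j then 1 else 0)"
      by (intro sum.cong) auto
    also have "\<dots> = card ?J"
      by (simp add: sum.If_cases Int_def)
    also have "\<dots> \<le> 1"
      using \<open>card ?J \<le> 1\<close> by simp
    finally show ?thesis
      using p unfolding i q_def prod.case by (intro powr_le1) (simp_all add: abs_of_nonneg sum_nonneg)
  qed
  show "(\<lambda>k. q i (X k)) \<longlonglongrightarrow> q i x" if "\<And>n. (\<lambda>k. X k n) \<longlonglongrightarrow> x n"
    using p that unfolding i q_def prod.case
    by (intro tendsto_powr_nonneg tendsto_sum tendsto_norm sum_nonneg) auto
qed

end

theory Submission
  imports Defs
begin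

text \<open>
  Write \<open>m\<^sub>1 < m\<^sub>2 < \<dots>\<close> and \<open>n\<^sub>1 < n\<^sub>2 < \<dots>\<close> for the elements of \<open>M\<close> and \<open>N\<close>. The three conditions are proved
  in a cycle: finite index, domination, operator, finite index.

  \<^emph>\<open>Finite index implies domination.\<close> If \<open>N(J)\<close> is a Schreier set, then \<open>M(J)\<close> is covered by \<open>K\<close> Schreier
  sets, and one of them, cut down to \<open>M(J)\<close>, carries at least the fraction \<open>1/K\<close> of any non-negative
  sum over \<open>M(J)\<close>. Hence every sum over a Schreier set that occurs in the norm of
  \<open>\<Sum> \<alpha>\<^sub>j e\<^bsub>n\<^sub>j\<^esub>\<close> is at most \<open>K\<close> times one that may occur in the norm of \<open>\<Sum> \<alpha>\<^sub>j e\<^bsub>m\<^sub>j\<^esub>\<close>; sets chosen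
  for the consecutive members of a chain are again consecutive
  (\<open>schreier_norm_transfer\<close>, \<open>baernstein_norm_transfer\<close>).

  \<^emph>\<open>Domination implies operator.\<close> Moving the \<open>j\<close>-th coordinate along \<open>M\<close> to the \<open>j\<close>-th coordinate along
  \<open>N\<close> defines an operator, and it maps \<open>e\<^bsub>m\<^sub>j\<^esub>\<close> to \<open>e\<^bsub>n\<^sub>j\<^esub>\<close> (\<open>operator_of_domination\<close>).

  \<^emph>\<open>Operator implies finite index.\<close> Choose \<open>\<delta> > 0\<close> and \<open>\<sigma> : M \<rightarrow> N\<close> such that the coordinate of \<open>T e\<^sub>m\<close> at
  \<open>\<sigma> m\<close> has modulus at least \<open>\<delta>\<close>. The test vectors are obtained from weights: non-negative functions
  on a finite set \<open>H\<close> whose sum over every Schreier set is at most 2. Let \<open>W\<close> be the total mass of a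
  weight \<open>w\<close>. In \<open>S\<^sub>p\<close> the vector \<open>w\<^bsup>1/p\<^esup>\<close> has norm at most \<open>2\<^bsup>1/p\<^esup>\<close>, and in \<open>B\<^sub>p\<close> the vector \<open>w\<close> has norm
  at most \<open>2 W\<^bsup>1/p\<^esup>\<close>. If \<open>\<sigma>(H)\<close> is a Schreier set, then for a suitable choice of signs the
  image of this vector, already on the set \<open>\<sigma>(H)\<close>, has norm at least \<open>\<delta> W\<^bsup>1/p\<^esup>\<close> in \<open>S\<^sub>p\<close>
  and \<open>\<delta> W\<close> in \<open>B\<^sub>p\<close>. So \<open>W \<le> K\<close> for a constant \<open>K\<close> that depends only on \<open>T\<close>, \<open>\<delta>\<close> and the space
  (\<open>weight_bounded_by_operator\<close>). The rest is combinatorics.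

  First, the fibres of \<open>\<sigma>\<close> have at most \<open>B\<close> elements for some \<open>B\<close>. Otherwise finite sets with uniform
  weights could be chosen in the fibres, each much larger than the maximum of the one before, so that
  their weights add up to a single weight of large mass, while their few values under \<open>\<sigma>\<close> form a
  Schreier set (\<open>bounded_fibres\<close>).

  Now let \<open>N(J)\<close> be a Schreier set with \<open>i = min J\<close>, so that \<open>|J| \<le> n\<^sub>i\<close>. Cut \<open>M(J)\<close> greedily into \<open>r\<close> successive
  Schreier sets, all but the last one maximal. Giving mass 1 to each maximal piece produces a weight
  of mass at least \<open>r - 1\<close> (\<open>greedy_schreier_decomposition\<close>). The points with \<open>\<sigma> m \<ge> n\<^sub>i\<close> have at most
  \<open>|J| \<le> n\<^sub>i\<close> values under \<open>\<sigma>\<close>, which thus form a Schreier set, so they carry mass at most \<open>K\<close>. The points with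
  \<open>\<sigma> m < n\<^sub>i\<close> lie in the \<open>i - 1\<close> fibres over \<open>n\<^sub>1, \<dots>, n\<^bsub>i-1\<^esub>\<close>, so there are at most \<open>B (i - 1)\<close> of
  them, each of weight at most \<open>1 / m\<^sub>i \<le> 1 / i\<close>; they carry mass at most \<open>B\<close>. Hence
  \<open>r \<le> K + B + 1\<close>, which bounds the covering number of \<open>M(J)\<close> (\<open>covering_numbers_bounded\<close>).
\<close>


section \<open>Schreier sets and weights\<close>

lemma schreier_sets_iff:
  "F \<in> schreier_sets \<longleftrightarrow> finite F \<and> F \<subseteq> {1..} \<and> (\<forall>n\<in>F. card F \<le> n)"
proof (cases "F = {} \<or> infinite F")
  case False
  then have "card F \<le> Min F \<longleftrightarrow> (\<forall>n\<in>F. card F \<le> n)"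
    by (intro Min_ge_iff) auto
  then show ?thesis
    using False by (simp add: schreier_sets_def)
qed (auto simp: schreier_sets_def)

lemma schreier_sets_subset: "F \<in> schreier_sets \<Longrightarrow> G \<subseteq> F \<Longrightarrow> G \<in> schreier_sets"
  unfolding schreier_sets_iff by (meson card_mono finite_subset order_trans subsetD)

text \<open>
  Weights are the powers of the moduli of test vectors whose norm stays small although their total
  mass is large. The bound is 2, and not 1, because that is what the constructions below can
  maintain: one piece of mass 1 that a Schreier set contains in full, and at most 1 from all later
  pieces together.
\<close>
definition schreier_weight :: "nat set \<Rightarrow> (nat \<Rightarrow> real) \<Rightarrow> bool" where
  "schreier_weight A w \<longleftrightarrow>
     (\<forall>n. 0 \<le> w n) \<and> (\<forall>n. n \<notin> A \<longrightarrow> w n = 0) \<and> (\<forall>F\<in>schreier_sets. sum w F \<le> 2)"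

lemma schreier_weight_zero: "schreier_weight A (\<lambda>_. 0)"
  by (simp add: schreier_weight_def)

lemma schreier_weight_restrict:
  assumes "schreier_weight A w"
  shows "schreier_weight H (\<lambda>n. if n \<in> H then w n else 0)"
proof -
  have "(\<Sum>n\<in>F. if n \<in> H then w n else 0) \<le> sum w F" for F
    using assms by (intro sum_mono) (auto simp: schreier_weight_def)
  moreover have "sum w F \<le> 2" if "F \<in> schreier_sets" for F
    using assms that by (simp add: schreier_weight_def)
  ultimately have "(\<Sum>n\<in>F. if n \<in> H then w n else 0) \<le> 2" if "F \<in> schreier_sets" for F
    using that order_trans by blast
  then show ?thesis
    using assms by (auto simp: schreier_weight_def)
qed

text \<open>
  A Schreier set that meets \<open>G\<close> has at most \<open>b\<close> elements, since \<open>b\<close> bounds \<open>G\<close>. It therefore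
  collects at most \<open>b * (1 / b) = 1\<close> outside \<open>G\<close>, besides the mass 1 of \<open>G\<close> itself. A Schreier set
  that misses \<open>G\<close> only sees \<open>w\<close>. This step is the source of all weights of large mass.
\<close>
lemma schreier_weight_stack:
  assumes G: "finite G" "G \<noteq> {}" "G \<subseteq> {1..}" and A: "finite A" "G \<inter> A = {}"
    and w: "schreier_weight A w" "\<And>n. w n \<le> 1 / real b" and b: "\<And>g. g \<in> G \<Longrightarrow> g \<le> b"
  defines "v \<equiv> \<lambda>n. if n \<in> G then 1 / real (card G) else w n"
  shows "schreier_weight (G \<union> A) v" "sum v (G \<union> A) = 1 + sum w A"
proof -
  have cG: "card G > 0"
    using G by (simp add: card_gt_0_iff)
  have nonneg: "0 \<le> w n" for n
    using w(1) by (simp add: schreier_weight_def)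
  have "sum v F \<le> 2" if F: "F \<in> schreier_sets" for F
  proof (cases "F \<inter> G = {}")
    case True
    then have "sum v F = sum w F"
      by (intro sum.cong) (auto simp: v_def)
    then show ?thesis
      using w(1) F by (simp add: schreier_weight_def)
  next
    case False
    then obtain g where g: "g \<in> F" "g \<in> G"
      by blast
    have finF: "finite F" and "card F \<le> g"
      using F g by (auto simp: schreier_sets_iff)
    then have card: "card F \<le> b" and "b \<ge> 1"
      using b[OF g(2)] G(3) g(2) by auto
    have "sum v F = sum v (F \<inter> G) + sum v (F - G)"
      using finF by (metis sum.Int_Diff)
    also have "sum v (F \<inter> G) = real (card (F \<inter> G)) / real (card G)"
      by (simp add: v_def)
    also have "\<dots> \<le> 1"
      using G cG by (simp add: card_mono)
    also have "sum v (F - G) \<le> real (card (F - G)) * (1 / real b)"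
      using w(2) by (intro sum_bounded_above) (auto simp: v_def)
    also have "\<dots> \<le> real b * (1 / real b)"
      using card card_mono[of F "F - G"] finF by (intro mult_right_mono) auto
    also have "\<dots> = 1"
      using \<open>b \<ge> 1\<close> by simp
    finally show ?thesis
      by simp
  qed
  then show "schreier_weight (G \<union> A) v"
    using w(1) by (auto simp: schreier_weight_def v_def)
  have "sum v (G \<union> A) = sum v G + sum v A"
    using G A by (intro sum.union_disjoint)
  also have "sum v G = 1"
    using cG by (simp add: v_def)
  also have "sum v A = sum w A"
    using A by (intro sum.cong) (auto simp: v_def)
  finally show "sum v (G \<union> A) = 1 + sum w A" .
qed

section \<open>Greedy decomposition and the covering number\<close>

lemma initial_segment_of_card:
  fixes A :: "nat set"
  assumes "finite A" "k \<le> card A"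
  shows "\<exists>G\<subseteq>A. card G = k \<and> (\<forall>g\<in>G. \<forall>a\<in>A - G. g < a)"
  using assms(2)
proof (induction k)
  case 0
  show ?case
    by (intro exI[of _ "{}"]) auto
next
  case (Suc k)
  then obtain G where G: "G \<subseteq> A" "card G = k" "\<forall>g\<in>G. \<forall>a\<in>A - G. g < a"
    by auto
  have ne: "A - G \<noteq> {}"
  proof
    assume "A - G = {}"
    then have "A = G"
      using G(1) by blast
    then show False
      using G(2) Suc.prems by simp
  qed
  define b where "b = Min (A - G)"
  have b: "b \<in> A - G"
    unfolding b_def using ne assms(1) by (intro Min_in) auto
  have "b < a" if "a \<in> A - insert b G" for a
  proof -
    have "b \<le> a"
      unfolding b_def using that assms(1) by (intro Min_le) auto
    then show ?thesis
      using that by (cases "a = b") auto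
  qed
  then show ?case
    using G b assms(1)
    by (intro exI[of _ "insert b G"]) (auto simp: finite_subset[OF G(1)])
qed

lemma schreier_chain_Cons:
  assumes G: "G \<in> schreier_sets - {{}}" and chain: "schreier_chain m F"
    and less: "\<And>g a. g \<in> G \<Longrightarrow> a \<in> (\<Union>j\<in>{1..m}. F j) \<Longrightarrow> g < a"
  shows "schreier_chain (Suc m) (\<lambda>j. if j = 1 then G else F (j - 1))"
    and "(\<Union>j\<in>{1..Suc m}. if j = 1 then G else F (j - 1)) = G \<union> (\<Union>j\<in>{1..m}. F j)"
proof -
  let ?F = "\<lambda>j. if j = 1 then G else F (j - 1)"
  have mem: "F j \<in> schreier_sets - {{}}" if "1 \<le> j" "j \<le> m" for j
    using chain that by (auto simp: schreier_chain_def)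
  have "?F j \<in> schreier_sets - {{}}" if "j \<in> {1..Suc m}" for j
  proof (cases "j = 1")
    case False
    then have "1 \<le> j - 1" "j - 1 \<le> m"
      using that by auto
    then show ?thesis
      using False mem by simp
  qed (use G in simp)
  moreover have "Max (?F j) < Min (?F (j + 1))" if j: "1 \<le> j" "j < Suc m" for j
  proof (cases "j = 1")
    case True
    have "finite G" "G \<noteq> {}" "finite (F 1)" "F 1 \<noteq> {}"
      using G mem[of 1] j by (auto simp: schreier_sets_iff)
    then have "Max G \<in> G" "Min (F 1) \<in> F 1"
      by (auto intro: Max_in Min_in)
    moreover have "1 \<in> {1..m}"
      using True j by simp
    ultimately have "Max G < Min (F 1)"
      using less by blast
    then show ?thesis
      using True by simp
  next
    case False
    then obtain k where k: "j = Suc k" "1 \<le> k" "k < m"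
      using j by (cases j) auto
    then have "Max (F k) < Min (F (k + 1))"
      using chain by (simp add: schreier_chain_def)
    then show ?thesis
      using k by simp
  qed
  ultimately show "schreier_chain (Suc m) ?F"
    by (auto simp: schreier_chain_def)
  have "{1..Suc m} = insert 1 (Suc ` {1..m})"
    by (simp add: atLeastAtMost_insertL image_Suc_atLeastAtMost)
  then have "(\<Union>j\<in>{1..Suc m}. ?F j) = ?F 1 \<union> (\<Union>j\<in>Suc ` {1..m}. ?F j)"
    by (simp only: UN_insert)
  also have "(\<Union>j\<in>Suc ` {1..m}. ?F j) = (\<Union>j\<in>{1..m}. F j)"
    unfolding image_image by (intro SUP_cong) auto
  finally show "(\<Union>j\<in>{1..Suc m}. ?F j) = G \<union> (\<Union>j\<in>{1..m}. F j)"
    by simp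
qed

text \<open>
  Split off the first \<open>Min A\<close> elements of \<open>A\<close>, a maximal Schreier set \<open>G\<close>, until a Schreier set
  remains. Each \<open>G\<close> receives the uniform weight of mass 1, the last piece the weight 0. Later points
  have weight at most the reciprocal of the minimum of what remains after \<open>G\<close>, and this minimum bounds
  \<open>G\<close>; so the pieces can be stacked. The covering sets have union exactly \<open>A\<close>, which is what allows \<open>G\<close> to
  be put in front of a chain for the remainder.
\<close>
theorem greedy_schreier_decomposition:
  assumes "finite A" "A \<noteq> {}" "A \<subseteq> {1..}"
  shows "\<exists>m F w. 1 \<le> m \<and> schreier_chain m F \<and> (\<Union>j\<in>{1..m}. F j) = A \<and>
           schreier_weight A w \<and> (\<forall>n. w n \<le> 1 / real (Min A)) \<and> real m \<le> sum w A + 1"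
  using assms
proof (induction "card A" arbitrary: A rule: less_induct)
  case less
  show ?case
  proof (cases "A \<in> schreier_sets")
    case True
    then show ?thesis
      using less.prems schreier_weight_zero[of A]
      by (intro exI[of _ 1] exI[of _ "\<lambda>_. A"] exI[of _ "\<lambda>_. 0"]) (auto simp: schreier_chain_def)
  next
    case False
    define a where "a = Min A"
    have a: "a \<in> A" "\<And>n. n \<in> A \<Longrightarrow> a \<le> n"
      using less.prems by (auto simp: a_def)
    have acard: "a < card A"
      using False less.prems a by (force simp: schreier_sets_iff)
    obtain G where G: "G \<subseteq> A" "card G = a" "\<And>g x. g \<in> G \<Longrightarrow> x \<in> A - G \<Longrightarrow> g < x"
      using initial_segment_of_card[OF less.prems(1), of a] acard by auto
    have a1: "1 \<le> a"
      using a less.prems by auto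
    have finG: "finite G" and neG: "G \<noteq> {}"
      using G less.prems a1 by (auto intro: finite_subset)
    have GS: "G \<in> schreier_sets - {{}}"
      using finG neG G a less.prems by (auto simp: schreier_sets_iff)
    define A' where "A' = A - G"
    have A': "finite A'" "A' \<noteq> {}" "A' \<subseteq> {1..}" "card A' < card A"
      using less.prems G acard a1 finG unfolding A'_def
      by (auto simp: card_Diff_subset dest: card_mono[OF finG])
    obtain m F w where IH: "1 \<le> m" "schreier_chain m F" "(\<Union>j\<in>{1..m}. F j) = A'"
        "schreier_weight A' w" "\<And>n. w n \<le> 1 / real (Min A')" "real m \<le> sum w A' + 1"
      using less.hyps[OF A'(4,1-3)] by blast
    have un: "G \<union> A' = A" and dis: "G \<inter> A' = {}"
      using G by (auto simp: A'_def)
    have GN: "G \<subseteq> {1..}"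
      using G(1) less.prems by blast
    have Min': "Min A' \<in> A'"
      using A' by simp
    let ?v = "\<lambda>n. if n \<in> G then 1 / real (card G) else w n"
    have GMin: "g \<le> Min A'" if "g \<in> G" for g
      using G(3)[OF that, of "Min A'"] Min' by (simp add: A'_def)
    have v: "schreier_weight A ?v" "sum ?v A = 1 + sum w A'"
      using schreier_weight_stack[OF finG neG GN A'(1) dis IH(4,5) GMin] unfolding un by simp_all
    have "a \<le> Min A'"
      using a Min' by (auto simp: A'_def)
    then have "1 / real (Min A') \<le> 1 / real a"
      using a1 by (simp add: frac_le)
    then have bd: "\<forall>n. ?v n \<le> 1 / real (Min A)"
      using IH(5) G by (auto simp: a_def[symmetric] intro: order_trans)
    have less': "g < x" if "g \<in> G" "x \<in> (\<Union>j\<in>{1..m}. F j)" for g x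
      using that IH(3) G(3)[of g x] by (auto simp: A'_def)
    let ?F = "\<lambda>j. if j = 1 then G else F (j - 1)"
    have "schreier_chain (Suc m) ?F" "(\<Union>j\<in>{1..Suc m}. ?F j) = A"
      using schreier_chain_Cons[OF GS IH(2) less'] unfolding IH(3) un by simp_all
    moreover have "1 \<le> Suc m" "real (Suc m) \<le> sum ?v A + 1"
      using IH(6) unfolding v(2) by simp_all
    ultimately show ?thesis
      using v(1) bd
      by (intro exI[of _ "Suc m"] exI[of _ ?F] exI[of _ ?v]) (intro conjI; assumption)
  qed
qed

lemma schreier_covering_number_le:
  assumes "1 \<le> m" "schreier_chain m F" "A \<subseteq> (\<Union>j\<in>{1..m}. F j)"
  shows "schreier_covering_number A \<le> m"
  using assms by (auto simp: schreier_covering_number_def intro!: Least_le)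

lemma schreier_covering_numberE:
  assumes "finite A" "A \<noteq> {}" "A \<subseteq> {1..}"
  obtains F where "1 \<le> schreier_covering_number A" "schreier_chain (schreier_covering_number A) F"
    "A \<subseteq> (\<Union>j\<in>{1..schreier_covering_number A}. F j)"
proof -
  let ?P = "\<lambda>m. 1 \<le> m \<and> (\<exists>F. schreier_chain m F \<and> A \<subseteq> (\<Union>j\<in>{1..m}. F j))"
  have "\<exists>m. ?P m"
    using greedy_schreier_decomposition[OF assms] by blast
  then have "?P (LEAST m. ?P m)"
    by (rule LeastI_ex)
  then show ?thesis
    using that assms(2) by (auto simp: schreier_covering_number_def)
qed

lemma sum_UN_le:
  fixes f :: "'a \<Rightarrow> real"
  assumes "finite I" "\<And>i. i \<in> I \<Longrightarrow> finite (A i)" "\<And>x. 0 \<le> f x"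
  shows "sum f (\<Union>i\<in>I. A i) \<le> (\<Sum>i\<in>I. sum f (A i))"
  using assms(1,2)
proof (induction I rule: finite_induct)
  case (insert i I)
  have "sum f (A i \<union> (\<Union>i\<in>I. A i)) + sum f (A i \<inter> (\<Union>i\<in>I. A i))
      = sum f (A i) + sum f (\<Union>i\<in>I. A i)"
    using insert by (intro sum.union_inter) auto
  moreover have "0 \<le> sum f (A i \<inter> (\<Union>i\<in>I. A i))"
    using assms(3) by (simp add: sum_nonneg)
  moreover have "sum f (\<Union>i\<in>I. A i) \<le> (\<Sum>i\<in>I. sum f (A i))"
    using insert by simp
  ultimately show ?case
    using insert.hyps by simp
qed simp

text \<open>
  Pigeonhole principle over a cover by at most \<open>K\<close> Schreier sets. Cutting the best member of the cover
  down to \<open>A\<close> keeps it a Schreier set; it is empty only if the sum vanishes, and then any singleton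
  serves.
\<close>
lemma schreier_subset_of_large_sum:
  fixes f :: "nat \<Rightarrow> real"
  assumes A: "finite A" "A \<noteq> {}" "A \<subseteq> {1..}" and K: "schreier_covering_number A \<le> K"
    and f: "\<And>n. 0 \<le> f n"
  shows "\<exists>G\<in>schreier_sets - {{}}. G \<subseteq> A \<and> sum f A \<le> real K * sum f G"
proof -
  let ?m = "schreier_covering_number A"
  obtain F where F: "1 \<le> ?m" "schreier_chain ?m F" "A \<subseteq> (\<Union>j\<in>{1..?m}. F j)"
    using schreier_covering_numberE[OF A] by blast
  let ?s = "\<lambda>j. sum f (A \<inter> F j)"
  have "finite (?s ` {1..?m})" "?s ` {1..?m} \<noteq> {}"
    using F(1) by auto
  then obtain c where c: "c \<in> {1..?m}" "?s c = Max (?s ` {1..?m})"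
    using Max_in[of "?s ` {1..?m}"] by (metis (no_types, lifting) imageE)
  have cmax: "?s j \<le> ?s c" if "j \<in> {1..?m}" for j
    using that c(2) by simp
  have "sum f A \<le> sum f (\<Union>j\<in>{1..?m}. A \<inter> F j)"
    using F(3) A f by (intro sum_mono2) auto
  also have "\<dots> \<le> (\<Sum>j\<in>{1..?m}. ?s j)"
    using A f by (intro sum_UN_le) auto
  also have "\<dots> \<le> real (card {1..?m}) * ?s c"
    using cmax by (intro sum_bounded_above)
  also have "\<dots> \<le> real K * ?s c"
    using K f by (intro mult_right_mono) (auto simp: sum_nonneg)
  finally have sum: "sum f A \<le> real K * ?s c" .
  show ?thesis
  proof (cases "A \<inter> F c = {}")
    case False
    have "F c \<in> schreier_sets"
      using F(2) c(1) by (auto simp: schreier_chain_def)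
    then have "A \<inter> F c \<in> schreier_sets"
      by (rule schreier_sets_subset) auto
    then show ?thesis
      using False sum by blast
  next
    case True
    obtain a where a: "a \<in> A"
      using A by blast
    then have "sum f A \<le> real K * sum f {a}"
      using sum True f[of a] by (simp add: order_trans[OF _ mult_nonneg_nonneg])
    then show ?thesis
      using a A singleton_schreier[of a] by blast
  qed
qed

section \<open>Fibres of a map that is bounded on weights\<close>

text \<open>
  If the fibres of \<open>\<sigma>\<close> over \<open>Q\<close> contain, beyond every bound \<open>s\<close>, more than \<open>s\<close> points, then uniform
  weights on parts of fibres can be stacked: each part is taken beyond the maximum of the previous ones,
  and is so large that its weight is below the reciprocal of that maximum. The mass \<open>r\<close> is reached
  with at most \<open>r\<close> values of \<open>\<sigma>\<close>. The induction builds from the right, which is why the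
  statement holds beyond an arbitrary \<open>s\<close> and bounds the weight by \<open>1 / Suc s\<close>.
\<close>
lemma weight_on_fibres:
  fixes \<sigma> :: "nat \<Rightarrow> nat"
  assumes M: "M \<subseteq> {1..}"
    and big: "\<And>s. \<exists>n\<in>Q. \<exists>A. finite A \<and> A \<subseteq> {m \<in> M. \<sigma> m = n} \<and> A \<subseteq> {s<..} \<and> s < card A"
  shows "\<exists>H w. finite H \<and> H \<subseteq> M \<and> H \<subseteq> {s<..} \<and> \<sigma> ` H \<subseteq> Q \<and> card (\<sigma> ` H) \<le> r \<and>
           schreier_weight H w \<and> (\<forall>n. w n \<le> 1 / real (Suc s)) \<and> sum w H = real r"
proof (induction r arbitrary: s)
  case 0
  show ?case
    using schreier_weight_zero[of "{}"] by (intro exI[of _ "{}"] exI[of _ "\<lambda>_. 0"]) simp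
next
  case (Suc r)
  obtain n A where n: "n \<in> Q" and A: "finite A" "A \<subseteq> {m \<in> M. \<sigma> m = n}" "A \<subseteq> {s<..}" "s < card A"
    using big[of s] by blast
  define t where "t = Max A"
  have ne: "A \<noteq> {}"
    using A(4) by auto
  have t: "a \<le> t" if "a \<in> A" for a
    using A(1) that by (simp add: t_def)
  have st: "s < t"
    using Max_in[OF A(1) ne] A(3) by (auto simp: t_def)
  obtain H w where H: "finite H" "H \<subseteq> M" "H \<subseteq> {t<..}" "\<sigma> ` H \<subseteq> Q" "card (\<sigma> ` H) \<le> r"
      and w: "schreier_weight H w" "\<And>n. w n \<le> 1 / real (Suc t)" "sum w H = real r"
    using Suc.IH[of t] by blast
  have dis: "A \<inter> H = {}"
    using t H(3) by force
  have tS: "a \<le> Suc t" if "a \<in> A" for a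
    using t[OF that] by simp
  have A1: "A \<subseteq> {1..}"
    using A(2) M by blast
  let ?v = "\<lambda>n. if n \<in> A then 1 / real (card A) else w n"
  have v: "schreier_weight (A \<union> H) ?v" "sum ?v (A \<union> H) = 1 + sum w H"
    by (rule schreier_weight_stack[OF A(1) ne A1 H(1) dis w(1,2) tS], assumption+)+
  have "1 / real (Suc t) \<le> 1 / real (Suc s)"
    using st by (intro frac_le) auto
  moreover have "1 / real (card A) \<le> 1 / real (Suc s)"
    using A(4) by (intro frac_le) auto
  ultimately have "\<forall>n. ?v n \<le> 1 / real (Suc s)"
    using order_trans[OF w(2)] by simp
  moreover have "sum ?v (A \<union> H) = real (Suc r)"
    unfolding v(2) w(3) by simp
  moreover have "card (\<sigma> ` (A \<union> H)) \<le> Suc r"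
  proof -
    have "\<sigma> ` (A \<union> H) \<subseteq> insert n (\<sigma> ` H)"
      using A(2) by auto
    then have "card (\<sigma> ` (A \<union> H)) \<le> card (insert n (\<sigma> ` H))"
      using H(1) by (intro card_mono) auto
    also have "\<dots> \<le> Suc r"
      using H(1,5) by (simp add: card_insert_if)
    finally show ?thesis .
  qed
  moreover have "\<sigma> ` (A \<union> H) \<subseteq> Q" "A \<union> H \<subseteq> M"
    using A(2) n H(2,4) by auto
  moreover have "A \<union> H \<subseteq> {s<..}"
    using A(3) H(3) st by force
  moreover have "finite (A \<union> H)"
    using A(1) H(1) by simp
  ultimately show ?case
    using v(1) by (intro exI[of _ "A \<union> H"] exI[of _ ?v]) (intro conjI; assumption)
qed

text \<open>
  With \<open>r > K\<close>, a weight of mass \<open>r\<close> whose values under \<open>\<sigma>\<close> form a Schreier set is impossible. An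
  infinite fibre would give such a weight with a single value. If the fibres are finite but of
  unbounded size, large ones exist over arbitrarily large values; using only values that are at least \<open>r\<close>,
  the at most \<open>r\<close> values needed form a Schreier set.
\<close>
lemma bounded_fibres:
  fixes \<sigma> :: "nat \<Rightarrow> nat" and K :: real
  assumes M: "M \<subseteq> {1..}" and \<sigma>: "\<sigma> ` M \<subseteq> {1..}"
    and K: "\<And>H w. finite H \<Longrightarrow> H \<subseteq> M \<Longrightarrow> \<sigma> ` H \<in> schreier_sets \<Longrightarrow> schreier_weight H w \<Longrightarrow> sum w H \<le> K"
  shows "\<exists>B. \<forall>n. finite {m \<in> M. \<sigma> m = n} \<and> card {m \<in> M. \<sigma> m = n} \<le> B"
proof -
  obtain r :: nat where r: "K < real r"
    using reals_Archimedean2 by blast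
  have no_weight: False if "finite H" "H \<subseteq> M" "card (\<sigma> ` H) \<le> r" "schreier_weight H w" "sum w H = real r"
      and "\<sigma> ` H \<in> schreier_sets" for H w
    using K[OF that(1,2,6,4)] that(5) r by simp
  have fin: "finite {m \<in> M. \<sigma> m = n}" for n
  proof (rule ccontr)
    assume inf: "infinite {m \<in> M. \<sigma> m = n}"
    have "\<exists>A. finite A \<and> A \<subseteq> {m \<in> M. \<sigma> m = n} \<and> A \<subseteq> {s<..} \<and> s < card A" for s
    proof -
      have "infinite ({m \<in> M. \<sigma> m = n} - {..s})"
        using inf by simp
      then obtain A where "finite A" "card A = Suc s" "A \<subseteq> {m \<in> M. \<sigma> m = n} - {..s}"
        using infinite_arbitrarily_large by blast
      then show ?thesis
        by (intro exI[of _ A]) auto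
    qed
    then obtain H w where H: "finite H" "H \<subseteq> M" "\<sigma> ` H \<subseteq> {n}" "card (\<sigma> ` H) \<le> r"
        "schreier_weight H w" "sum w H = real r"
      using weight_on_fibres[OF M, of "{n}" \<sigma> 0 r] by auto
    have "n \<ge> 1"
      using inf \<sigma> by (metis (mono_tags, lifting) atLeast_iff empty_Collect_eq image_subset_iff finite.emptyI)
    then have "\<sigma> ` H \<in> schreier_sets"
      using schreier_sets_subset[OF singleton_schreier H(3)] by simp
    then show False
      using no_weight H by blast
  qed
  have "\<exists>B. \<forall>n. card {m \<in> M. \<sigma> m = n} \<le> B"
  proof (rule ccontr)
    assume nb: "\<nexists>B. \<forall>n. card {m \<in> M. \<sigma> m = n} \<le> B"
    have "\<exists>n\<in>{r..} \<inter> {1..}. \<exists>A. finite A \<and> A \<subseteq> {m \<in> M. \<sigma> m = n} \<and> A \<subseteq> {s<..} \<and> s < card A" for s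
    proof -
      \<comment> \<open>A fibre with more than \<open>b\<close> points lies over a value \<open>n \<ge> r\<close>; the surplus \<open>2 * s + 1\<close> leaves more
        than \<open>s\<close> points after the \<open>s + 1\<close> points up to \<open>s\<close> are removed.\<close>
      define b where "b = (\<Sum>n<r. card {m \<in> M. \<sigma> m = n})"
      have "\<not> (\<forall>n. card {m \<in> M. \<sigma> m = n} \<le> b + 2 * s + 1)"
        using nb by blast
      then obtain n where n: "card {m \<in> M. \<sigma> m = n} > b + 2 * s + 1"
        by (auto simp: not_le)
      have "r \<le> n"
      proof (rule ccontr)
        assume "\<not> r \<le> n"
        then have "card {m \<in> M. \<sigma> m = n} \<le> b"
          unfolding b_def by (intro member_le_sum) auto
        then show False
          using n by simp
      qed
      moreover have "n \<ge> 1"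
      proof -
        have "{m \<in> M. \<sigma> m = n} \<noteq> {}"
          using n by (metis card.empty not_less_zero)
        then show ?thesis
          using \<sigma> by auto
      qed
      moreover have "s < card ({m \<in> M. \<sigma> m = n} - {..s})"
        using n diff_card_le_card_Diff[of "{..s}" "{m \<in> M. \<sigma> m = n}"] by simp
      ultimately show ?thesis
        using fin[of n] by (intro bexI[of _ n] exI[of _ "{m \<in> M. \<sigma> m = n} - {..s}"]) auto
    qed
    then obtain H w where H: "finite H" "H \<subseteq> M" "\<sigma> ` H \<subseteq> {r..} \<inter> {1..}" "card (\<sigma> ` H) \<le> r"
        "schreier_weight H w" "sum w H = real r"
      using weight_on_fibres[OF M, of "{r..} \<inter> {1..}" \<sigma> 0 r] by auto
    then have "\<sigma> ` H \<in> schreier_sets"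
      unfolding schreier_sets_iff using order_trans[OF H(4)] by auto
    then show False
      using no_weight H by blast
  qed
  then show ?thesis
    using fin by blast
qed

lemma Suc_le_enumerate:
  assumes "infinite M" "M \<subseteq> {1..}"
  shows "Suc i \<le> enumerate M i"
proof (induction i)
  case 0
  show ?case
    using enumerate_in_set[OF assms(1), of 0] assms(2) by auto
next
  case (Suc i)
  then show ?case
    using enumerate_mono[of i "Suc i" M] assms(1) by linarith
qed

text \<open>
  The index enters only through \<open>card J \<le> n\<close>, where \<open>n\<close> is the least element of \<open>N\<close> selected by \<open>J\<close>.
  The greedy weight on the set selected in \<open>M\<close> is split according to whether \<open>\<sigma>\<close> takes a value at least
  \<open>n\<close>, where the hypothesis on weights applies, or below \<open>n\<close>, where there are few values, hence
  few points. Enumerations start at 0, so with \<open>i = Min J\<close> there are \<open>i\<close> elements of \<open>N\<close> below \<open>n\<close> and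
  all selected elements of \<open>M\<close> are at least \<open>Suc i\<close>.
\<close>
theorem covering_numbers_bounded:
  fixes \<sigma> :: "nat \<Rightarrow> nat" and K :: real
  assumes M: "infinite M" "M \<subseteq> {1..}" and N: "infinite N" "N \<subseteq> {1..}" and \<sigma>: "\<sigma> ` M \<subseteq> N"
    and K: "\<And>H w. finite H \<Longrightarrow> H \<subseteq> M \<Longrightarrow> \<sigma> ` H \<in> schreier_sets \<Longrightarrow> schreier_weight H w \<Longrightarrow> sum w H \<le> K"
  shows "\<exists>C. \<forall>J. finite J \<longrightarrow> enumerate N ` J \<in> schreier_sets \<longrightarrow>
           schreier_covering_number (enumerate M ` J) \<le> C"
proof -
  have \<sigma>1: "\<sigma> ` M \<subseteq> {1..}"
    using \<sigma> N(2) by blast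
  obtain B where B: "\<And>n. finite {m \<in> M. \<sigma> m = n}" "\<And>n. card {m \<in> M. \<sigma> m = n} \<le> B"
    using bounded_fibres[OF M(2) \<sigma>1 K] by blast
  have bound: "real (schreier_covering_number (enumerate M ` J)) \<le> K + real B + 1"
    if J: "finite J" "enumerate N ` J \<in> schreier_sets" "J \<noteq> {}" for J
  proof -
    define A where "A = enumerate M ` J"
    have A: "finite A" "A \<noteq> {}" "A \<subseteq> M" "A \<subseteq> {1..}"
      using J enumerate_in_set[OF M(1)] M(2) by (auto simp: A_def)
    have cardA: "card A \<le> card J"
      unfolding A_def by (intro card_image_le J)
    define i where "i = Min J"
    have i: "i \<in> J" "\<And>j. j \<in> J \<Longrightarrow> i \<le> j"
      using J by (auto simp: i_def)
    define n where "n = enumerate N i"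
    have "inj_on (enumerate N) J"
      using N(1) by (meson inj_enumerate inj_on_subset subset_UNIV)
    then have "card J = card (enumerate N ` J)"
      by (simp add: card_image)
    also have "\<dots> \<le> n"
      using J(2) i(1) unfolding schreier_sets_iff n_def by blast
    finally have cardJ: "card J \<le> n" .
    obtain m F w where gr: "1 \<le> m" "schreier_chain m F" "(\<Union>j\<in>{1..m}. F j) = A"
        "schreier_weight A w" "\<And>n. w n \<le> 1 / real (Min A)" "real m \<le> sum w A + 1"
      using greedy_schreier_decomposition[OF A(1,2,4)] by blast
    have "Min A \<in> A"
      using A by simp
    then obtain j where "j \<in> J" "Min A = enumerate M j"
      by (auto simp: A_def)
    then have Min: "Suc i \<le> Min A"
      using i(2)[of j] Suc_le_enumerate[OF M, of j] by simp
    have w: "w a \<le> 1 / real (Suc i)" for a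
    proof -
      have "1 / real (Min A) \<le> 1 / real (Suc i)"
        using Min by (intro frac_le) auto
      then show ?thesis
        using gr(5)[of a] by simp
    qed
    define H where "H = {a \<in> A. n \<le> \<sigma> a}"
    define L where "L = {a \<in> A. \<sigma> a < n}"
    have H: "finite H" "H \<subseteq> M" and "H \<subseteq> A"
      using A by (auto simp: H_def)
    have "card (\<sigma> ` H) \<le> card A"
      using A(1) \<open>H \<subseteq> A\<close> by (meson H(1) card_image_le card_mono order_trans)
    then have "card (\<sigma> ` H) \<le> n"
      using cardA cardJ by simp
    then have "\<sigma> ` H \<in> schreier_sets"
      unfolding schreier_sets_iff using H \<sigma>1 by (auto simp: H_def)
    from K[OF H this schreier_weight_restrict[OF gr(4)]] have sumH: "sum w H \<le> K"
      by simp
    have "L \<subseteq> (\<Union>j\<in>{..<i}. {a \<in> M. \<sigma> a = enumerate N j})"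
    proof
      fix a assume a: "a \<in> L"
      then have "\<sigma> a \<in> N" "a \<in> M" "\<sigma> a < n"
        using A(3) \<sigma> by (auto simp: L_def)
      moreover from this(1) obtain j where "\<sigma> a = enumerate N j"
        using N(1) by (metis bij_betw_imp_surj_on bij_enumerate imageE)
      ultimately show "a \<in> (\<Union>j\<in>{..<i}. {a \<in> M. \<sigma> a = enumerate N j})"
        using N(1) by (auto simp: n_def)
    qed
    then have "card L \<le> card (\<Union>j\<in>{..<i}. {a \<in> M. \<sigma> a = enumerate N j})"
      using B(1) by (intro card_mono) auto
    also have "\<dots> \<le> (\<Sum>j<i. card {a \<in> M. \<sigma> a = enumerate N j})"
      by (intro card_UN_le) simp
    also have "\<dots> \<le> i * B"
      using sum_bounded_above[of "{..<i}" "\<lambda>j. card {a \<in> M. \<sigma> a = enumerate N j}" B] B(2) by simp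
    finally have cardL: "card L \<le> i * B" .
    have "sum w L \<le> real (card L) * (1 / real (Suc i))"
      using w by (intro sum_bounded_above)
    also have "\<dots> \<le> real (Suc i * B) * (1 / real (Suc i))"
      using cardL by (intro mult_right_mono) (simp_all add: le_trans del: of_nat_mult of_nat_Suc)
    also have "\<dots> = real B"
      by (simp add: field_simps)
    finally have sumL: "sum w L \<le> real B" .
    have "A = H \<union> L" "H \<inter> L = {}"
      by (auto simp: H_def L_def)
    then have "sum w A = sum w H + sum w L"
      using A(1) by (metis finite_Un sum.union_disjoint)
    moreover have "schreier_covering_number A \<le> m"
      using schreier_covering_number_le[OF gr(1,2)] gr(3) by simp
    ultimately show ?thesis
      using sumH sumL gr(6) by (simp add: A_def[symmetric])
  qed
  have "schreier_covering_number (enumerate M ` J) \<le> nat \<lceil>K + real B + 1\<rceil>"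
    if "finite J" "enumerate N ` J \<in> schreier_sets" for J
  proof (cases "J = {}")
    case False
    then show ?thesis
      using bound[OF that] by linarith
  qed (simp add: schreier_covering_number_def)
  then show ?thesis
    by blast
qed

section \<open>Signs and inequalities for powers\<close>

lemma powr_norm_le_average:
  fixes a b :: "'k::real_normed_field" and q :: real
  assumes "1 \<le> q"
  shows "2 * norm a powr q \<le> norm (a + b) powr q + norm (a - b) powr q"
proof -
  have "2 * norm a = norm ((a + b) + (a - b))"
    by (simp add: norm_mult flip: mult_2)
  also have "\<dots> \<le> norm (a + b) + norm (a - b)"
    by (rule norm_triangle_ineq)
  finally have "norm a \<le> 1 / 2 * norm (a + b) + (1 - 1 / 2) * norm (a - b)"
    by argo
  then have "norm a powr q \<le> (1 / 2 * norm (a + b) + (1 - 1 / 2) * norm (a - b)) powr q"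
    using assms by (intro powr_mono2) auto
  also have "\<dots> \<le> 1 / 2 * norm (a + b) powr q + (1 - 1 / 2) * norm (a - b) powr q"
    using assms by (intro powr_convex_combination) auto
  finally show ?thesis
    by simp
qed

text \<open>
  Signs are chosen one index at a time. By convexity, averaging \<open>\<plusminus> u a\<close> over both signs does not
  decrease the contribution of an old coordinate, and at the new coordinate \<open>a\<close> the average is at
  least the contribution of \<open>u a a\<close>; so one of the two signs is good. Thus interference
  between the vectors \<open>u w\<close> cannot destroy their diagonal parts.
\<close>
lemma signs_keep_diagonal:
  fixes u :: "'a \<Rightarrow> 'a \<Rightarrow> 'k::real_normed_field" and q :: real
  assumes "finite W" and q: "1 \<le> q"
  shows "\<exists>\<epsilon>::'a \<Rightarrow> 'k. (\<forall>w. norm (\<epsilon> w) = 1) \<and>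
           (\<Sum>v\<in>W. norm (u v v) powr q) \<le> (\<Sum>v\<in>W. norm (\<Sum>w\<in>W. \<epsilon> w * u w v) powr q)"
  using assms(1)
proof (induction W rule: finite_induct)
  case empty
  show ?case
    by (intro exI[of _ "\<lambda>_. 1"]) simp
next
  case (insert a W)
  obtain \<epsilon> :: "'a \<Rightarrow> 'k" where \<epsilon>: "\<And>w. norm (\<epsilon> w) = 1"
      "(\<Sum>v\<in>W. norm (u v v) powr q) \<le> (\<Sum>v\<in>W. norm (\<Sum>w\<in>W. \<epsilon> w * u w v) powr q)"
    using insert.IH by blast
  define r where "r v = (\<Sum>w\<in>W. \<epsilon> w * u w v)" for v
  define \<Phi> where "\<Phi> s = (\<Sum>v\<in>insert a W. norm (r v + s * u a v) powr q)" for s :: 'k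
  have eq: "(\<Sum>v\<in>insert a W. norm (\<Sum>w\<in>insert a W. (\<epsilon>(a := s)) w * u w v) powr q) = \<Phi> s" for s
  proof -
    have "(\<Sum>w\<in>insert a W. (\<epsilon>(a := s)) w * u w v) = r v + s * u a v" for v
    proof -
      have "(\<Sum>w\<in>W. (\<epsilon>(a := s)) w * u w v) = r v"
        unfolding r_def using insert.hyps(2) by (intro sum.cong) auto
      then show ?thesis
        using insert.hyps by (simp add: add.commute)
    qed
    then show ?thesis
      by (simp only: \<Phi>_def)
  qed
  have "2 * (\<Sum>v\<in>insert a W. norm (u v v) powr q)
      \<le> 2 * (norm (u a a) powr q + (\<Sum>v\<in>W. norm (r v) powr q))"
    using \<epsilon>(2) insert.hyps by (simp add: r_def)
  also have "\<dots> = 2 * norm (u a a) powr q + (\<Sum>v\<in>W. 2 * norm (r v) powr q)"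
    by (simp add: sum_distrib_left)
  also have "\<dots> \<le> (norm (r a + u a a) powr q + norm (r a - u a a) powr q)
      + (\<Sum>v\<in>W. norm (r v + u a v) powr q + norm (r v - u a v) powr q)"
    using powr_norm_le_average[OF q, of "u a a" "r a"]
    by (intro add_mono sum_mono powr_norm_le_average q)
       (simp_all add: add.commute norm_minus_commute)
  also have "\<dots> = \<Phi> 1 + \<Phi> (- 1)"
    using insert.hyps by (simp add: \<Phi>_def sum.distrib)
  finally have "(\<Sum>v\<in>insert a W. norm (u v v) powr q) \<le> \<Phi> 1 \<or>
      (\<Sum>v\<in>insert a W. norm (u v v) powr q) \<le> \<Phi> (- 1)"
    by linarith
  then obtain s where s: "norm s = 1" "(\<Sum>v\<in>insert a W. norm (u v v) powr q) \<le> \<Phi> s"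
    by (metis norm_minus_cancel norm_one)
  show ?case
    using s \<epsilon>(1) eq[of s] by (intro exI[of _ "\<epsilon>(a := s)"]) auto
qed

lemma sum_powr_le_powr_sum:
  fixes x :: "'a \<Rightarrow> real"
  assumes "finite A" "1 \<le> q" and x: "\<And>a. a \<in> A \<Longrightarrow> 0 \<le> x a"
  shows "(\<Sum>a\<in>A. x a powr q) \<le> (\<Sum>a\<in>A. x a) powr q"
proof -
  let ?S = "\<Sum>a\<in>A. x a"
  have split: "y powr q = y * y powr (q - 1)" if "0 \<le> y" for y :: real
    using that by (cases "y = 0") (auto simp: powr_mult_base)
  have "(\<Sum>a\<in>A. x a powr q) = (\<Sum>a\<in>A. x a * x a powr (q - 1))"
    using split x by (intro sum.cong) auto
  also have "\<dots> \<le> (\<Sum>a\<in>A. x a * ?S powr (q - 1))"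
    using assms by (intro sum_mono mult_left_mono powr_mono2) (auto intro: member_le_sum)
  also have "\<dots> = ?S powr q"
    using split[of ?S] x by (simp add: sum_nonneg sum_distrib_right)
  finally show ?thesis .
qed

section \<open>Coordinates and closed spans\<close>

lemma sum_scaled_unit_vectors:
  assumes "finite H"
  shows "(\<Sum>m\<in>H. c m *\<^sub>s unit_vector m) = (\<lambda>n. if n \<in> H then c n else 0)"
proof
  fix k
  have "(\<Sum>m\<in>H. c m *\<^sub>s unit_vector m) k = (\<Sum>m\<in>H. (c m *\<^sub>s unit_vector m) k)"
    using assms by (induction rule: finite_induct) auto
  also have "\<dots> = (\<Sum>m\<in>H. if m = k then c m else 0)"
    by (rule sum.cong) (auto simp: seq_scale_def unit_vector_def)
  finally show "(\<Sum>m\<in>H. c m *\<^sub>s unit_vector m) k = (if k \<in> H then c k else 0)"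
    using assms by simp
qed

lemma span_unit_vectors:
  "module.span seq_scale (unit_vector ` N) =
     {x :: nat \<Rightarrow> 'k::{real_normed_field, euclidean_space}. finite {n. x n \<noteq> 0} \<and> {n. x n \<noteq> 0} \<subseteq> N}"
  (is "_ = ?S")
proof (intro antisym subsetI)
  fix x :: "nat \<Rightarrow> 'k"
  assume "x \<in> module.span seq_scale (unit_vector ` N)"
  moreover have "module.span seq_scale (unit_vector ` N) \<subseteq> ?S"
  proof (rule module.span_minimal[OF module_seq_scale])
    show "unit_vector ` N \<subseteq> ?S"
      by (auto simp: unit_vector_def split: if_splits)
    show "module.subspace seq_scale ?S"
    proof (rule module.subspaceI[OF module_seq_scale])
      fix c :: 'k and x y :: "nat \<Rightarrow> 'k"
      show "0 \<in> ?S"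
        by simp
      assume x: "x \<in> ?S"
      have "{n. (c *\<^sub>s x) n \<noteq> 0} \<subseteq> {n. x n \<noteq> 0}"
        by (auto simp: seq_scale_def)
      then show "c *\<^sub>s x \<in> ?S"
        using x by (auto intro: finite_subset)
      assume y: "y \<in> ?S"
      have "{n. (x + y) n \<noteq> 0} \<subseteq> {n. x n \<noteq> 0} \<union> {n. y n \<noteq> 0}"
        by auto
      moreover have "finite ({n. x n \<noteq> 0} \<union> {n. y n \<noteq> 0})" "{n. x n \<noteq> 0} \<union> {n. y n \<noteq> 0} \<subseteq> N"
        using x y by simp_all
      ultimately have "finite {n. (x + y) n \<noteq> 0}" "{n. (x + y) n \<noteq> 0} \<subseteq> N"
        by (meson finite_subset, blast)
      then show "x + y \<in> ?S"
        by blast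
    qed
  qed
  ultimately show "x \<in> ?S"
    by blast
next
  fix x :: "nat \<Rightarrow> 'k" assume x: "x \<in> ?S"
  have "x = (\<Sum>n | x n \<noteq> 0. x n *\<^sub>s unit_vector n)"
    using x by (subst sum_scaled_unit_vectors) auto
  also have "\<dots> \<in> module.span seq_scale (unit_vector ` N)"
    using x
    by (intro module.span_sum[OF module_seq_scale] module.span_scale[OF module_seq_scale]
        module.span_base[OF module_seq_scale]) auto
  finally show "x \<in> module.span seq_scale (unit_vector ` N)" .
qed

context coordinate_norm
begin

lemma span_subset_closed_span:
  assumes "N \<subseteq> {1..}"
  shows "module.span seq_scale (unit_vector ` N) \<subseteq> closed_span nrm N"
proof
  fix x :: "nat \<Rightarrow> 'k" assume x: "x \<in> module.span seq_scale (unit_vector ` N)"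
  then have "x \<in> c00_completion nrm"
    using span_unit_vectors_subset_c00[OF assms] c00_subset_completion by blast
  moreover have "nrm (x - x) < ennreal \<epsilon>" if "\<epsilon> > 0" for \<epsilon>
    using that by simp
  ultimately show "x \<in> closed_span nrm N"
    using x unfolding closed_span_def by blast
qed

lemma unit_vector_in_closed_span:
  assumes "N \<subseteq> {1..}" "n \<in> N"
  shows "unit_vector n \<in> closed_span nrm N"
  using span_subset_closed_span[OF assms(1)] module.span_base[OF module_seq_scale] assms(2) by blast

lemma closed_span_zero_outside:
  assumes N: "N \<subseteq> {1..}" and x: "x \<in> closed_span nrm N" and n: "n \<notin> N"
  shows "x n = 0"
proof (cases "n = 0")
  case True
  then show ?thesis
    using x completion_zero_coord by (simp add: closed_span_def)
next
  case False
  have "norm (x n) \<le> \<epsilon>" if eps: "\<epsilon> > 0" for \<epsilon>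
  proof -
    obtain y where y: "y \<in> module.span seq_scale (unit_vector ` N)" "nrm (x - y) < ennreal \<epsilon>"
      using x eps unfolding closed_span_def by blast
    have "y n = 0"
      using y(1) n unfolding span_unit_vectors by blast
    then have "ennreal (norm (x n)) < ennreal \<epsilon>"
      using coordinate_le[of n "x - y"] False y(2) by simp
    then show ?thesis
      using eps by (simp add: ennreal_less_iff)
  qed
  then show ?thesis
    using field_le_epsilon[of "norm (x n)" 0] by simp
qed

lemma operator_sum:
  assumes T: "T \<in> bounded_operators nrm (closed_span nrm M) Y" and M: "M \<subseteq> {1..}"
    and H: "finite H" "H \<subseteq> M"
  shows "T (\<Sum>m\<in>H. c m *\<^sub>s unit_vector m) = (\<Sum>m\<in>H. c m *\<^sub>s T (unit_vector m))"
  using H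
proof (induction H rule: finite_induct)
  case empty
  have "0 \<in> closed_span nrm M"
    using span_subset_closed_span[OF M] module.span_zero[OF module_seq_scale] by blast
  then have "T (0 + 0) = T 0 + T 0"
    using T unfolding bounded_operators_def by blast
  then have "T 0 = 0"
    by simp
  then show ?case
    by (simp only: sum.empty)
next
  case (insert a H)
  have a: "unit_vector a \<in> closed_span nrm M"
    using insert.prems unit_vector_in_closed_span[OF M] by simp
  have span: "c m *\<^sub>s unit_vector m \<in> module.span seq_scale (unit_vector ` M)" if "m \<in> M" for m
    using that by (intro module.span_scale[OF module_seq_scale] module.span_base[OF module_seq_scale]) simp
  then have "c a *\<^sub>s unit_vector a \<in> closed_span nrm M"
    "(\<Sum>m\<in>H. c m *\<^sub>s unit_vector m) \<in> closed_span nrm M"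
    using insert.prems span_subset_closed_span[OF M]
    by (auto intro!: subsetD[OF span_subset_closed_span[OF M]] module.span_sum[OF module_seq_scale])
  then have "T (c a *\<^sub>s unit_vector a + (\<Sum>m\<in>H. c m *\<^sub>s unit_vector m))
      = T (c a *\<^sub>s unit_vector a) + T (\<Sum>m\<in>H. c m *\<^sub>s unit_vector m)"
    using T unfolding bounded_operators_def by blast
  moreover have "T (c a *\<^sub>s unit_vector a) = c a *\<^sub>s T (unit_vector a)"
    using T a unfolding bounded_operators_def by blast
  moreover have "T (\<Sum>m\<in>H. c m *\<^sub>s unit_vector m) = (\<Sum>m\<in>H. c m *\<^sub>s T (unit_vector m))"
    using insert.IH insert.prems by blast
  ultimately show ?case
    unfolding sum.insert[OF insert.hyps(1,2)] by (simp only:)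
qed

end

section \<open>The common features of the two norms\<close>

text \<open>
  The implications from domination to an operator, and from an operator to a finite index, rest on
  three properties shared by the two families: the norm depends monotonically on the moduli, it dominates the \<open>\<ell>\<^sub>q\<close> norm on each Schreier set, and the
  vector \<open>w\<^bsup>1/q\<^esup>\<close> of a weight \<open>w\<close> of mass \<open>W\<close> has norm at most \<open>(2 W\<^bsup>\<theta>\<^esup>)\<^bsup>1/q\<^esup>\<close>, where \<open>\<theta> < 1\<close>. The norm
  of \<open>S\<^sub>p\<close> has \<open>q = p\<close> and \<open>\<theta> = 0\<close>, that of \<open>B\<^sub>p\<close> has \<open>q = 1\<close> and \<open>\<theta> = 1/p\<close>. The gap between \<open>\<theta>\<close> and 1
  is what makes \<open>\<delta>\<^bsup>q\<^esup> W \<le> 2 C\<^bsup>q\<^esup> W\<^bsup>\<theta>\<^esup>\<close> a bound for \<open>W\<close>.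
\<close>
locale schreier_type_norm = coordinate_norm nrm
  for nrm :: "(nat \<Rightarrow> 'k::{real_normed_field, euclidean_space}) \<Rightarrow> ennreal" +
  fixes q \<theta> :: real
  assumes q: "1 \<le> q" and \<theta>: "0 \<le> \<theta>" "\<theta> < 1"
    and solid: "(\<And>n. norm (x n) \<le> norm (y n)) \<Longrightarrow> nrm x \<le> nrm y"
    and lower: "F \<in> schreier_sets \<Longrightarrow> ennreal ((\<Sum>n\<in>F. norm (x n) powr q) powr (1 / q)) \<le> nrm x"
    and upper: "finite H \<Longrightarrow> schreier_weight H w \<Longrightarrow> 0 < sum w H \<Longrightarrow>
      nrm (\<lambda>n. of_real (w n powr (1 / q))) \<le> ennreal ((2 * sum w H powr \<theta>) powr (1 / q))"
begin

text \<open>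
  The test vector has modulus \<open>w\<^bsup>1/q\<^esup>\<close>. Its phases are chosen in two layers. Within the fibre over \<open>v\<close>, the
  phase \<open>\<eta> m\<close> rotates the coordinate of \<open>T e\<^sub>m\<close> at \<open>v\<close> to the positive axis, so that nothing cancels there.
  Across fibres, the signs \<open>\<epsilon> v\<close> protect the diagonal
  coordinates from the other fibres. Solidity makes the norm of the vector independent of both.
\<close>
lemma weight_bounded_by_operator:
  assumes T: "T \<in> bounded_operators nrm (closed_span nrm M) (closed_span nrm N)" and M: "M \<subseteq> {1..}"
    and \<delta>: "0 < \<delta>" and \<sigma>: "\<And>m. m \<in> M \<Longrightarrow> \<delta> \<le> norm (T (unit_vector m) (\<sigma> m))"
  shows "\<exists>K. \<forall>H w. finite H \<longrightarrow> H \<subseteq> M \<longrightarrow> \<sigma> ` H \<in> schreier_sets \<longrightarrow> schreier_weight H w \<longrightarrow> sum w H \<le> K"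
proof -
  obtain C0 where C0: "\<And>x. x \<in> closed_span nrm M \<Longrightarrow> nrm (T x) \<le> ennreal C0 * nrm x"
    using T unfolding bounded_operators_def by blast
  define C where "C = max C0 0"
  have C: "C \<ge> 0" "\<And>x. x \<in> closed_span nrm M \<Longrightarrow> nrm (T x) \<le> ennreal C * nrm x"
  proof -
    fix x :: "nat \<Rightarrow> 'k" assume "x \<in> closed_span nrm M"
    then have "nrm (T x) \<le> ennreal C0 * nrm x"
      by (rule C0)
    also have "\<dots> \<le> ennreal C * nrm x"
      by (intro mult_right_mono ennreal_leI) (auto simp: C_def)
    finally show "nrm (T x) \<le> ennreal C * nrm x" .
  qed (simp add: C_def)
  define K where "K = (2 * (C / \<delta>) powr q) powr (1 / (1 - \<theta>))"
  have "sum w H \<le> K" if H: "finite H" "H \<subseteq> M" "\<sigma> ` H \<in> schreier_sets" and w: "schreier_weight H w" for H w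
  proof (cases "0 < sum w H")
    case False
    moreover have "0 \<le> K"
      by (simp add: K_def)
    ultimately show ?thesis
      by linarith
  next
    case pos: True
    have w0: "0 \<le> w n" for n
      using w by (simp add: schreier_weight_def)
    define x where "x m = w m powr (1 / q)" for m
    define V where "V = \<sigma> ` H"
    have V: "finite V" "V \<in> schreier_sets"
      using H by (auto simp: V_def)
    define t where "t m = T (unit_vector m) (\<sigma> m)" for m
    have t: "\<delta> \<le> norm (t m)" "t m \<noteq> 0" if "m \<in> H" for m
      using \<sigma>[of m] that H(2) \<delta> by (auto simp: t_def)
    define \<eta> where "\<eta> m = of_real (norm (t m)) / t m" for m
    have \<eta>: "norm (\<eta> m) = 1" "\<eta> m * t m = of_real (norm (t m))" if "m \<in> H" for m
      using t(2)[OF that] by (auto simp: \<eta>_def norm_divide)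
    \<comment> \<open>\<open>u v\<close> is the image under \<open>T\<close> of the part of the test vector on the fibre over \<open>v\<close>, before signs.\<close>
    define u where "u v k = (\<Sum>m\<in>{m\<in>H. \<sigma> m = v}. (\<eta> m * of_real (x m)) * T (unit_vector m) k)" for v k
    have udiag: "\<delta> powr q * (\<Sum>m\<in>{m\<in>H. \<sigma> m = v}. w m) \<le> norm (u v v) powr q" for v
    proof -
      have "u v v = (\<Sum>m\<in>{m\<in>H. \<sigma> m = v}. of_real (x m * norm (t m)))"
        unfolding u_def
      proof (intro sum.cong refl)
        fix m assume "m \<in> {m \<in> H. \<sigma> m = v}"
        then have m: "m \<in> H" "\<sigma> m = v" by auto
        have "(\<eta> m * of_real (x m)) * T (unit_vector m) v = of_real (x m) * (\<eta> m * t m)"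
          using m by (simp add: t_def mult_ac)
        also have "\<dots> = of_real (x m * norm (t m))"
          using \<eta>(2)[OF m(1)] by simp
        finally show "(\<eta> m * of_real (x m)) * T (unit_vector m) v = of_real (x m * norm (t m))" .
      qed
      then have "u v v = of_real (\<Sum>m\<in>{m\<in>H. \<sigma> m = v}. x m * norm (t m))"
        by simp
      moreover have "0 \<le> (\<Sum>m\<in>{m\<in>H. \<sigma> m = v}. x m * norm (t m))"
        by (intro sum_nonneg) (simp add: x_def)
      ultimately have "norm (u v v) = (\<Sum>m\<in>{m\<in>H. \<sigma> m = v}. x m * norm (t m))"
        by (simp only: norm_of_real abs_of_nonneg)
      moreover have "(\<Sum>m\<in>{m\<in>H. \<sigma> m = v}. x m * \<delta>) \<le> (\<Sum>m\<in>{m\<in>H. \<sigma> m = v}. x m * norm (t m))"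
        using t(1) by (intro sum_mono mult_left_mono) (auto simp: x_def)
      ultimately have "\<delta> * (\<Sum>m\<in>{m\<in>H. \<sigma> m = v}. x m) \<le> norm (u v v)"
        by (simp add: sum_distrib_left mult.commute)
      then have "(\<delta> * (\<Sum>m\<in>{m\<in>H. \<sigma> m = v}. x m)) powr q \<le> norm (u v v) powr q"
        using q \<delta> by (intro powr_mono2) (auto simp: x_def sum_nonneg)
      moreover have "(\<delta> * (\<Sum>m\<in>{m\<in>H. \<sigma> m = v}. x m)) powr q = \<delta> powr q * (\<Sum>m\<in>{m\<in>H. \<sigma> m = v}. x m) powr q"
        by (simp add: powr_mult)
      moreover have "(\<Sum>m\<in>{m\<in>H. \<sigma> m = v}. w m) \<le> (\<Sum>m\<in>{m\<in>H. \<sigma> m = v}. x m) powr q"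
      proof -
        have "x m powr q = w m" for m
          using q w0[of m] by (simp add: x_def powr_powr)
        then show ?thesis
          using sum_powr_le_powr_sum[of "{m\<in>H. \<sigma> m = v}" q x] q H(1) by (simp add: x_def)
      qed
      then have "\<delta> powr q * (\<Sum>m\<in>{m\<in>H. \<sigma> m = v}. w m) \<le> \<delta> powr q * (\<Sum>m\<in>{m\<in>H. \<sigma> m = v}. x m) powr q"
        by (intro mult_left_mono) auto
      ultimately show ?thesis
        by linarith
    qed
    obtain \<epsilon> :: "nat \<Rightarrow> 'k" where \<epsilon>: "\<And>v. norm (\<epsilon> v) = 1"
        "(\<Sum>v\<in>V. norm (u v v) powr q) \<le> (\<Sum>k\<in>V. norm (\<Sum>v\<in>V. \<epsilon> v * u v k) powr q)"
      using signs_keep_diagonal[OF V(1) q, of u] by blast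
    define c where "c m = \<epsilon> (\<sigma> m) * (\<eta> m * of_real (x m))" for m
    define z where "z = (\<Sum>m\<in>H. c m *\<^sub>s unit_vector m)"
    have zM: "z \<in> closed_span nrm M"
      unfolding z_def using H(2)
      by (intro subsetD[OF span_subset_closed_span[OF M]] module.span_sum[OF module_seq_scale]
          module.span_scale[OF module_seq_scale] module.span_base[OF module_seq_scale]) auto
    have Tz: "T z k = (\<Sum>v\<in>V. \<epsilon> v * u v k)" for k
    proof -
      have "T z k = (\<Sum>m\<in>H. c m *\<^sub>s T (unit_vector m)) k"
        unfolding z_def operator_sum[OF T M H(1,2)] ..
      also have "\<dots> = (\<Sum>m\<in>H. c m * T (unit_vector m) k)"
        using H(1) by (induction rule: finite_induct) (auto simp: seq_scale_def)
      also have "\<dots> = (\<Sum>v\<in>V. \<Sum>m\<in>{m\<in>H. \<sigma> m = v}. c m * T (unit_vector m) k)"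
        unfolding V_def by (rule sum.image_gen[OF H(1)])
      also have "\<dots> = (\<Sum>v\<in>V. \<epsilon> v * u v k)"
        unfolding u_def sum_distrib_left by (intro sum.cong) (auto simp: c_def mult_ac)
      finally show ?thesis .
    qed
    define W where "W = sum w H"
    have "\<delta> powr q * W = (\<Sum>v\<in>V. \<delta> powr q * (\<Sum>m\<in>{m\<in>H. \<sigma> m = v}. w m))"
      unfolding W_def V_def by (subst sum.image_gen[OF H(1), of _ \<sigma>]) (rule sum_distrib_left)
    also have "\<dots> \<le> (\<Sum>v\<in>V. norm (u v v) powr q)"
      by (intro sum_mono udiag)
    also have "\<dots> \<le> (\<Sum>k\<in>V. norm (T z k) powr q)"
      using \<epsilon>(2) by (simp add: Tz)
    finally have "ennreal ((\<delta> powr q * W) powr (1 / q)) \<le> ennreal ((\<Sum>k\<in>V. norm (T z k) powr q) powr (1 / q))"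
      using q pos by (intro ennreal_leI powr_mono2) (auto simp: W_def)
    also have "\<dots> \<le> nrm (T z)"
      by (rule lower[OF V(2)])
    also have "\<dots> \<le> ennreal C * nrm z"
      by (rule C(2)[OF zM])
    also have "nrm z \<le> nrm (\<lambda>n. of_real (w n powr (1 / q)))"
    proof (rule solid)
      fix n
      show "norm (z n) \<le> norm (of_real (w n powr (1 / q)) :: 'k)"
        unfolding z_def sum_scaled_unit_vectors[OF H(1)]
        using \<epsilon>(1) \<eta>(1) by (simp add: c_def norm_mult x_def)
    qed
    also have "\<dots> \<le> ennreal ((2 * W powr \<theta>) powr (1 / q))"
      unfolding W_def by (rule upper[OF H(1) w pos])
    finally have "ennreal ((\<delta> powr q * W) powr (1 / q)) \<le> ennreal (C * (2 * W powr \<theta>) powr (1 / q))"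
      using C(1) by (simp add: ennreal_mult mult_left_mono)
    then have "(\<delta> powr q * W) powr (1 / q) \<le> C * (2 * W powr \<theta>) powr (1 / q)"
      using C(1) by (simp add: ennreal_le_iff)
    then have "((\<delta> powr q * W) powr (1 / q)) powr q \<le> (C * (2 * W powr \<theta>) powr (1 / q)) powr q"
      using q by (intro powr_mono2) auto
    then have "\<delta> powr q * W \<le> C powr q * (2 * W powr \<theta>)"
      using q pos C(1) \<delta> by (simp add: powr_powr powr_mult W_def)
    moreover have W: "W powr (1 - \<theta>) * W powr \<theta> = W"
      using pos by (simp add: W_def flip: powr_add)
    ultimately have "(\<delta> powr q * W powr (1 - \<theta>)) * W powr \<theta> \<le> (C powr q * 2) * W powr \<theta>"
      by (simp only: mult.assoc)
    then have "\<delta> powr q * W powr (1 - \<theta>) \<le> C powr q * 2"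
      using pos by (subst (asm) mult_le_cancel_right) (auto simp: W_def)
    then have "W powr (1 - \<theta>) \<le> 2 * (C / \<delta>) powr q"
      using \<delta> C(1) by (simp add: powr_divide field_simps)
    then have "(W powr (1 - \<theta>)) powr (1 / (1 - \<theta>)) \<le> K"
      unfolding K_def using \<theta> by (intro powr_mono2) auto
    then show ?thesis
      using pos \<theta> by (simp add: powr_powr W_def)
  qed
  then show ?thesis
    by blast
qed

theorem covering_numbers_bounded_of_operator:
  assumes M: "infinite M" "M \<subseteq> {1..}" and N: "infinite N" "N \<subseteq> {1..}"
    and T: "T \<in> bounded_operators nrm (closed_span nrm M) (closed_span nrm N)"
    and inf: "(INF m\<in>M. sup_norm (T (unit_vector m))) > 0"
  shows "\<exists>C. \<forall>J. finite J \<longrightarrow> enumerate N ` J \<in> schreier_sets \<longrightarrow>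
           schreier_covering_number (enumerate M ` J) \<le> C"
proof -
  obtain d where d: "0 < d" "d < (INF m\<in>M. sup_norm (T (unit_vector m)))"
    using dense[OF inf] by blast
  define \<delta> where "\<delta> = enn2real d"
  have dtop: "d < \<infinity>"
    using d(2) by (rule order.strict_trans2) simp
  have \<delta>: "0 < \<delta>" "d = ennreal \<delta>"
    using d(1) dtop by (auto simp: \<delta>_def enn2real_positive_iff)
  have "\<exists>n\<in>N. \<delta> \<le> norm (T (unit_vector m) n)" if m: "m \<in> M" for m
  proof -
    have "d < sup_norm (T (unit_vector m))"
      using d(2) INF_lower[OF m, of "\<lambda>m. sup_norm (T (unit_vector m))"] by (rule order.strict_trans2)
    then obtain n where n: "n \<ge> 1" "ennreal \<delta> < ennreal (norm (T (unit_vector m) n))"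
      unfolding sup_norm_def less_SUP_iff \<delta>(2) by auto
    then have "\<delta> < norm (T (unit_vector m) n)"
      using \<delta>(1) by (simp add: ennreal_less_iff)
    moreover have "T (unit_vector m) \<in> closed_span nrm N"
      using T unit_vector_in_closed_span[OF M(2) m] unfolding bounded_operators_def by blast
    ultimately show ?thesis
      using closed_span_zero_outside[OF N(2)] \<delta>(1) by (metis less_eq_real_def norm_zero order_less_asym)
  qed
  then obtain \<sigma> where \<sigma>: "\<And>m. m \<in> M \<Longrightarrow> \<sigma> m \<in> N" "\<And>m. m \<in> M \<Longrightarrow> \<delta> \<le> norm (T (unit_vector m) (\<sigma> m))"
    by metis
  obtain K where K: "\<And>H w. finite H \<Longrightarrow> H \<subseteq> M \<Longrightarrow> \<sigma> ` H \<in> schreier_sets \<Longrightarrow> schreier_weight H w \<Longrightarrow> sum w H \<le> K"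
    using weight_bounded_by_operator[OF T M(2) \<delta>(1) \<sigma>(2)] by blast
  have "\<sigma> ` M \<subseteq> N"
    using \<sigma>(1) by blast
  from covering_numbers_bounded[OF M N this K] show ?thesis .
qed

text \<open>
  The operator transports coordinates from \<open>M\<close> to \<open>N\<close>. Domination bounds it on truncations, and the
  bound passes to all sequences by solidity and the Fatou property of the norm. It maps finitely
  supported vectors to finitely supported ones, so by continuity it maps the closed span of \<open>M\<close> into that of \<open>N\<close>.
\<close>
theorem operator_of_domination:
  assumes M: "infinite M" "M \<subseteq> {1..}" and N: "infinite N" "N \<subseteq> {1..}"
    and dom: "dominates nrm (\<lambda>n. unit_vector (nth_element M n)) nrm (\<lambda>n. unit_vector (nth_element N n))"
  shows "\<exists>T\<in>bounded_operators nrm (closed_span nrm M) (closed_span nrm N).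
           (INF m\<in>M. sup_norm (T (unit_vector m))) > 0"
proof -
  have injM: "inj (enumerate M)" and injN: "inj (enumerate N)"
    using M N by (simp_all add: inj_enumerate)
  have ranM: "range (enumerate M) = M" and ranN: "range (enumerate N) = N"
    using M N by (simp_all add: range_enumerate)
  define \<phi> where "\<phi> k = enumerate M (inv (enumerate N) k)" for k
  have \<phi>: "\<phi> (enumerate N j) = enumerate M j" for j
    using injN by (simp add: \<phi>_def)
  define T where "T x = (\<lambda>k. if k \<in> N then x (\<phi> k) else 0)" for x :: "nat \<Rightarrow> 'k"
  obtain C where C: "C > 0" "\<And>r \<alpha>. r \<ge> 1 \<Longrightarrow>
      nrm (\<Sum>n=1..r. \<alpha> n *\<^sub>s unit_vector (nth_element N n))
        \<le> ennreal C * nrm (\<Sum>n=1..r. \<alpha> n *\<^sub>s unit_vector (nth_element M n))"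
    using dom unfolding dominates_def by blast
  have bounded: "nrm (T x) \<le> ennreal C * nrm x" for x
  proof -
    have trunc: "(\<Sum>n=1..r. x (nth_element M n) *\<^sub>s unit_vector (nth_element L n))
        = (\<lambda>k. if k \<in> enumerate L ` {..<r} then x (enumerate M (inv (enumerate L) k)) else 0)"
      if L: "inj (enumerate L)" for r L
    proof -
      have "(\<Sum>n=1..r. x (nth_element M n) *\<^sub>s unit_vector (nth_element L n))
          = (\<Sum>j<r. x (enumerate M j) *\<^sub>s unit_vector (enumerate L j))"
        by (rule sum.reindex_bij_witness[of _ Suc "\<lambda>n. n - 1"]) (auto simp: nth_element_def)
      also have "\<dots> = (\<Sum>k\<in>enumerate L ` {..<r}. x (enumerate M (inv (enumerate L) k)) *\<^sub>s unit_vector k)"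
        using L by (subst sum.reindex) (auto intro: inj_on_subset)
      finally show ?thesis
        by (simp only: sum_scaled_unit_vectors finite_imageI finite_lessThan)
    qed
    define X where "X r = (\<lambda>k. if k \<in> enumerate N ` {..<Suc r} then x (\<phi> k) else 0)" for r
    show ?thesis
    proof (rule fatou)
      fix k
      show "(\<lambda>r. X r k) \<longlonglongrightarrow> T x k"
      proof (cases "k \<in> N")
        case False
        then have "X r k = T x k" for r
          using enumerate_in_set[OF N(1)] by (auto simp: X_def T_def)
        then show ?thesis
          by simp
      next
        case True
        then obtain j where j: "k = enumerate N j"
          using ranN by blast
        have "X r k = T x k" if "j \<le> r" for r
          using that True j by (auto simp: X_def T_def)
        then have "\<forall>\<^sub>F r in sequentially. X r k = T x k"
          by (auto simp: eventually_sequentially)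
        then show ?thesis
          by (rule tendsto_eventually)
      qed
      show "nrm (X r) \<le> ennreal C * nrm x" for r
      proof -
        have "X r = (\<Sum>n=1..Suc r. x (nth_element M n) *\<^sub>s unit_vector (nth_element N n))"
          unfolding trunc[OF injN] by (simp only: X_def \<phi>_def)
        then have "nrm (X r) = nrm (\<Sum>n=1..Suc r. x (nth_element M n) *\<^sub>s unit_vector (nth_element N n))"
          by (simp only:)
        also have "\<dots> \<le> ennreal C * nrm (\<Sum>n=1..Suc r. x (nth_element M n) *\<^sub>s unit_vector (nth_element M n))"
          by (rule C(2)) simp
        also have "\<dots> \<le> ennreal C * nrm x"
          unfolding trunc[OF injM] using injM by (intro mult_left_mono solid) auto
        finally show ?thesis .
      qed
    qed
  qed
  have T_diff: "T x - T y = T (x - y)" for x y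
    by (auto simp: T_def)
  have T_span: "T y \<in> module.span seq_scale (unit_vector ` N)"
    if "y \<in> module.span seq_scale (unit_vector ` M)" for y
  proof -
    have fin: "finite {n. y n \<noteq> 0}"
      using that unfolding span_unit_vectors by blast
    have "inj_on \<phi> N"
    proof (rule inj_onI)
      fix a b assume "a \<in> N" "b \<in> N" "\<phi> a = \<phi> b"
      moreover from this(1,2) obtain i j where "a = enumerate N i" "b = enumerate N j"
        using ranN by blast
      ultimately show "a = b"
        using injM by (simp add: \<phi> inj_eq)
    qed
    then have "finite (\<phi> -` {n. y n \<noteq> 0} \<inter> N)"
      by (rule finite_vimage_IntI[OF fin])
    moreover have "{n. T y n \<noteq> 0} = \<phi> -` {n. y n \<noteq> 0} \<inter> N"
      by (auto simp: T_def)
    ultimately show ?thesis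
      unfolding span_unit_vectors by simp
  qed
  have T_closed: "T x \<in> closed_span nrm N" if x: "x \<in> closed_span nrm M" for x
  proof -
    have approx: "\<exists>y\<in>module.span seq_scale (unit_vector ` N). nrm (T x - y) < ennreal \<epsilon>" if eps: "\<epsilon> > 0" for \<epsilon>
    proof -
      have "\<epsilon> / C > 0"
        using eps C(1) by simp
      then obtain y where y: "y \<in> module.span seq_scale (unit_vector ` M)" "nrm (x - y) < ennreal (\<epsilon> / C)"
        using x unfolding closed_span_def by blast
      have "nrm (T x - T y) \<le> ennreal C * nrm (x - y)"
        unfolding T_diff by (rule bounded)
      also have "\<dots> < ennreal C * ennreal (\<epsilon> / C)"
        using y(2) C(1) by (intro ennreal_mult_strict_left_mono) auto
      also have "\<dots> = ennreal \<epsilon>"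
        using C(1) eps by (simp flip: ennreal_mult)
      finally show ?thesis
        using T_span[OF y(1)] by blast
    qed
    have "T x 0 = 0"
      using N(2) by (auto simp: T_def)
    then have "T x \<in> c00_completion nrm"
      using approx span_unit_vectors_subset_c00[OF N(2)]
      unfolding c00_completion_def seq_closure_def by blast
    then show ?thesis
      using approx unfolding closed_span_def by blast
  qed
  have "T \<in> bounded_operators nrm (closed_span nrm M) (closed_span nrm N)"
    unfolding bounded_operators_def
  proof (intro CollectI conjI ballI allI exI[of _ C])
    show "T (x + y) = T x + T y" for x y
      by (auto simp: T_def)
    show "T (c *\<^sub>s x) = c *\<^sub>s T x" for c x
      by (auto simp: T_def seq_scale_def)
  qed (auto intro: T_closed bounded)
  moreover have "1 \<le> (INF m\<in>M. sup_norm (T (unit_vector m)))"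
  proof (rule INF_greatest)
    fix m assume "m \<in> M"
    then obtain j where j: "m = enumerate M j"
      using ranM by blast
    have "enumerate N j \<in> N"
      using N(1) by (rule enumerate_in_set)
    then have "T (unit_vector m) (enumerate N j) = 1" "enumerate N j \<in> {1..}"
      using N(2) by (auto simp: T_def \<phi> j unit_vector_def)
    then show "1 \<le> sup_norm (T (unit_vector m))"
      unfolding sup_norm_def by (intro SUP_upper2[of "enumerate N j"]) auto
  qed
  then have "0 < (INF m\<in>M. sup_norm (T (unit_vector m)))"
    using less_le_trans[OF zero_less_one] by blast
  ultimately show ?thesis
    by blast
qed

end

section \<open>Schreier and Baernstein norms\<close>

lemma ennreal_powr_mono:
  "0 \<le> a \<Longrightarrow> a \<le> b \<Longrightarrow> 0 \<le> r \<Longrightarrow> ennreal (a powr r) \<le> ennreal (b powr r)"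
  by (intro ennreal_leI powr_mono2)

theorem schreier_type_norm_schreier_norm:
  fixes p :: real
  assumes p: "1 \<le> p"
  shows "schreier_type_norm (schreier_norm p :: (nat \<Rightarrow> 'k::{real_normed_field, euclidean_space}) \<Rightarrow> _) p 0"
proof (intro schreier_type_norm.intro coordinate_norm_schreier_norm[OF p] schreier_type_norm_axioms.intro)
  fix x y :: "nat \<Rightarrow> 'k" and F
  show "schreier_norm p x \<le> schreier_norm p y" if "\<And>n. norm (x n) \<le> norm (y n)"
    unfolding schreier_norm_def using that p
    by (intro SUP_mono' ennreal_powr_mono sum_nonneg sum_mono powr_mono2) auto
  show "ennreal ((\<Sum>n\<in>F. norm (x n) powr p) powr (1 / p)) \<le> schreier_norm p x" if "F \<in> schreier_sets"
  proof (cases "F = {}")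
    case False
    then show ?thesis
      unfolding schreier_norm_def using that by (intro SUP_upper) auto
  qed simp
next
  fix H w assume w: "schreier_weight H w" and pos: "0 < sum w H"
  have "(w n powr (1 / p)) powr p = w n" for n
    using w p by (simp add: schreier_weight_def powr_powr)
  then have "ennreal ((\<Sum>n\<in>F. norm (of_real (w n powr (1 / p)) :: 'k) powr p) powr (1 / p)) \<le> ennreal (2 powr (1 / p))"
    if "F \<in> schreier_sets" for F
    using w p that by (intro ennreal_powr_mono) (auto simp: schreier_weight_def sum_nonneg)
  then show "schreier_norm p (\<lambda>n. of_real (w n powr (1 / p)) :: 'k) \<le> ennreal ((2 * sum w H powr 0) powr (1 / p))"
    unfolding schreier_norm_def using pos by (intro SUP_least) auto
qed (use p in auto)

lemma sum_chain_le:
  fixes w :: "nat \<Rightarrow> real"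
  assumes F: "schreier_chain m F" and H: "finite H" and w: "\<And>n. 0 \<le> w n" "\<And>n. n \<notin> H \<Longrightarrow> w n = 0"
  shows "(\<Sum>j=1..m. sum w (F j)) \<le> sum w H"
proof -
  have fin: "finite (F j)" if "j \<in> {1..m}" for j
    using F that by (auto simp: schreier_chain_def schreier_sets_def)
  have "(\<Sum>j=1..m. sum w (F j)) = sum w (\<Union>j\<in>{1..m}. F j)"
    using fin schreier_chain_disjoint[OF F] by (intro sum.UNION_disjoint[symmetric]) blast+
  also have "\<dots> = sum w ((\<Union>j\<in>{1..m}. F j) \<inter> H)"
    using fin w(2) by (intro sum.mono_neutral_right) auto
  also have "\<dots> \<le> sum w H"
    using H w(1) by (intro sum_mono2) auto
  finally show ?thesis .
qed

text \<open>
  For the bound on a weight, the sums \<open>s\<^sub>j\<close> over the members of a chain satisfy \<open>s\<^sub>j \<le> 2\<close>, hence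
  \<open>s\<^sub>j\<^bsup>p\<^esup> \<le> 2\<^bsup>p-1\<^esup> s\<^sub>j\<close>, and they add up to at most the total mass because the members are disjoint.
\<close>
theorem schreier_type_norm_baernstein_norm:
  fixes p :: real
  assumes p: "1 < p"
  shows "schreier_type_norm (baernstein_norm p :: (nat \<Rightarrow> 'k::{real_normed_field, euclidean_space}) \<Rightarrow> _) 1 (1 / p)"
proof (intro schreier_type_norm.intro coordinate_norm_baernstein_norm[OF p] schreier_type_norm_axioms.intro)
  fix x y :: "nat \<Rightarrow> 'k" and F
  show "baernstein_norm p x \<le> baernstein_norm p y" if "\<And>n. norm (x n) \<le> norm (y n)"
    unfolding baernstein_norm_def case_prod_beta using that p
    by (intro SUP_mono' ennreal_powr_mono sum_nonneg sum_mono powr_mono2) (auto simp: sum_nonneg)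
  show "ennreal ((\<Sum>n\<in>F. norm (x n) powr 1) powr (1 / 1)) \<le> baernstein_norm p x" if F: "F \<in> schreier_sets"
  proof (cases "F = {}")
    case False
    have "schreier_chain 1 (\<lambda>_. F)"
      using F False by (simp add: schreier_chain_def)
    then show ?thesis
      unfolding baernstein_norm_def using p
      by (intro SUP_upper2[of "(1, \<lambda>_. F)"]) (auto simp: powr_powr sum_nonneg)
  qed simp
next
  fix H w assume H: "finite H" and w: "schreier_weight H w" and pos: "0 < sum w H"
  have w0: "0 \<le> w n" for n
    using w by (simp add: schreier_weight_def)
  have chain: "ennreal ((\<Sum>j=1..m. (\<Sum>n\<in>F j. norm (of_real (w n powr (1 / 1)) :: 'k)) powr p) powr (1 / p))
      \<le> ennreal ((2 * sum w H powr (1 / p)) powr (1 / 1))"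
    if F: "schreier_chain m F" for m F
  proof -
    have le: "sum w (F j) powr p \<le> 2 powr (p - 1) * sum w (F j)" if j: "j \<in> {1..m}" for j
    proof -
      have s: "0 \<le> sum w (F j)" "sum w (F j) \<le> 2"
        using w F j by (auto simp: schreier_weight_def schreier_chain_def sum_nonneg)
      have "sum w (F j) powr p = sum w (F j) powr (p - 1) * sum w (F j)"
        using s(1) powr_mult_base[of "sum w (F j)" "p - 1"] by (cases "sum w (F j) = 0") (auto simp: mult.commute)
      also have "\<dots> \<le> 2 powr (p - 1) * sum w (F j)"
        using s p by (intro mult_right_mono powr_mono2) auto
      finally show ?thesis .
    qed
    have "(\<Sum>j=1..m. sum w (F j) powr p) \<le> (\<Sum>j=1..m. 2 powr (p - 1) * sum w (F j))"
      by (intro sum_mono le)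
    also have "\<dots> \<le> 2 powr (p - 1) * sum w H"
      using sum_chain_le[OF F H, of w] w by (simp add: schreier_weight_def flip: sum_distrib_left)
    also have "\<dots> \<le> 2 powr p * sum w H"
      using pos by (intro mult_right_mono) auto
    finally have "(\<Sum>j=1..m. sum w (F j) powr p) powr (1 / p) \<le> (2 powr p * sum w H) powr (1 / p)"
      using p by (intro powr_mono2) (auto intro: sum_nonneg)
    also have "\<dots> = 2 * sum w H powr (1 / p)"
      using p by (simp add: powr_mult powr_powr)
    finally show ?thesis
      using w0 by (simp add: ennreal_leI)
  qed
  show "baernstein_norm p (\<lambda>n. of_real (w n powr (1 / 1)) :: 'k) \<le> ennreal ((2 * sum w H powr (1 / p)) powr (1 / 1))"
    unfolding baernstein_norm_def by (rule SUP_least, clarify) (rule chain)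
qed (use p in auto)

section \<open>Domination from a finite index\<close>

text \<open>
  Here \<open>g\<close> is \<open>f\<close> with its coordinates along \<open>M\<close> moved to \<open>N\<close>. The set \<open>G\<close> found by the pigeonhole principle
  stays inside the copy of \<open>F\<close> in \<open>M\<close>, so that successive sets \<open>F\<close> lead to successive sets \<open>G\<close>.
\<close>
lemma schreier_set_transfer:
  fixes f g :: "nat \<Rightarrow> real"
  assumes M: "infinite M" "M \<subseteq> {1..}" and N: "infinite N"
    and K: "\<And>J. finite J \<Longrightarrow> enumerate N ` J \<in> schreier_sets \<Longrightarrow>
              schreier_covering_number (enumerate M ` J) \<le> K"
    and f: "\<And>n. 0 \<le> f n"
    and g: "\<And>j. g (enumerate N j) = f (enumerate M j)" "\<And>n. n \<notin> N \<Longrightarrow> g n = 0"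
    and F: "F \<in> schreier_sets" "F \<inter> N \<noteq> {}"
  shows "\<exists>G\<in>schreier_sets - {{}}. G \<subseteq> enumerate M ` {j. enumerate N j \<in> F} \<and> sum g F \<le> real K * sum f G"
proof -
  have inj: "inj (enumerate M)" "inj (enumerate N)"
    using M N by (simp_all add: inj_enumerate)
  have finF: "finite F"
    using F by (simp add: schreier_sets_iff)
  define J where "J = {j. enumerate N j \<in> F}"
  have J: "finite J"
    using finite_vimageI[OF finF inj(2)] by (simp add: J_def vimage_def)
  have im: "enumerate N ` J = F \<inter> N"
    using range_enumerate[OF N] by (auto simp: J_def)
  have "schreier_covering_number (enumerate M ` J) \<le> K"
    by (rule K[OF J]) (use F(1) im schreier_sets_subset in auto)
  moreover have "enumerate M ` J \<subseteq> {1..}"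
    using enumerate_in_set[OF M(1)] M(2) by blast
  moreover have "enumerate M ` J \<noteq> {}"
    using im F(2) by auto
  ultimately obtain G where G: "G \<in> schreier_sets - {{}}" "G \<subseteq> enumerate M ` J"
      "sum f (enumerate M ` J) \<le> real K * sum f G"
    using schreier_subset_of_large_sum[of "enumerate M ` J" K f] J f by blast
  have "sum g F = sum g (F \<inter> N)"
    using finF g(2) by (intro sum.mono_neutral_right) auto
  also have "\<dots> = (\<Sum>j\<in>J. g (enumerate N j))"
    unfolding im[symmetric] using inj(2) by (simp add: sum.reindex inj_on_subset)
  also have "\<dots> = sum f (enumerate M ` J)"
    using inj(1) g(1) by (simp add: sum.reindex inj_on_subset)
  finally show ?thesis
    using G unfolding J_def by auto
qed

lemma powr_root_le:
  fixes K s :: real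
  assumes "1 \<le> p" "1 \<le> K" "0 \<le> s"
  shows "(K * s) powr (1 / p) \<le> K * s powr (1 / p)"
  using assms powr_mono[of "1 / p" 1 K] by (simp add: powr_mult mult_right_mono)

lemma schreier_norm_transfer:
  fixes x y :: "nat \<Rightarrow> 'k::{real_normed_field, euclidean_space}"
  assumes p: "1 \<le> p" and M: "infinite M" "M \<subseteq> {1..}" and N: "infinite N"
    and K: "\<And>J. finite J \<Longrightarrow> enumerate N ` J \<in> schreier_sets \<Longrightarrow>
              schreier_covering_number (enumerate M ` J) \<le> K" "1 \<le> K"
    and y: "\<And>j. y (enumerate N j) = x (enumerate M j)" "\<And>n. n \<notin> N \<Longrightarrow> y n = 0"
  shows "schreier_norm p y \<le> ennreal K * schreier_norm p x"
  unfolding schreier_norm_def[of p y]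
proof (rule SUP_least)
  interpret schreier_type_norm "schreier_norm p :: (nat \<Rightarrow> 'k) \<Rightarrow> _" p 0
    by (rule schreier_type_norm_schreier_norm[OF p])
  fix F assume F: "F \<in> schreier_sets - {{}}"
  let ?g = "\<lambda>n. norm (y n) powr p" and ?f = "\<lambda>n. norm (x n) powr p"
  show "ennreal (sum ?g F powr (1 / p)) \<le> ennreal K * schreier_norm p x"
  proof (cases "F \<inter> N = {}")
    case True
    then have "sum ?g F = 0"
      using y(2) by (intro sum.neutral) auto
    then show ?thesis
      by simp
  next
    case False
    obtain G where G: "G \<in> schreier_sets" "sum ?g F \<le> real K * sum ?f G"
      using schreier_set_transfer[OF M N K(1), of ?f ?g F] y F False by auto
    have "ennreal (sum ?g F powr (1 / p)) \<le> ennreal ((real K * sum ?f G) powr (1 / p))"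
      using G(2) p by (intro ennreal_powr_mono) (auto intro: sum_nonneg)
    also have "\<dots> \<le> ennreal (real K * sum ?f G powr (1 / p))"
      using p K(2) by (intro ennreal_leI powr_root_le) (auto intro: sum_nonneg)
    also have "\<dots> = ennreal K * ennreal (sum ?f G powr (1 / p))"
      by (simp add: ennreal_mult)
    also have "\<dots> \<le> ennreal K * schreier_norm p x"
      by (intro mult_left_mono lower G(1)) simp
    finally show ?thesis .
  qed
qed

text \<open>
  Chains are indexed without gaps. Members of a chain that do not meet \<open>N\<close> drop out when it is moved to
  \<open>M\<close>, so the remaining ones have to be renumbered.
\<close>
lemma baernstein_norm_ge:
  fixes x :: "nat \<Rightarrow> 'k::{real_normed_field, euclidean_space}" and I :: "nat set"
  assumes I: "finite I" and G: "\<And>i. i \<in> I \<Longrightarrow> G i \<in> schreier_sets - {{}}"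
    and less: "\<And>i j a b. i \<in> I \<Longrightarrow> j \<in> I \<Longrightarrow> i < j \<Longrightarrow> a \<in> G i \<Longrightarrow> b \<in> G j \<Longrightarrow> a < b"
  shows "ennreal ((\<Sum>i\<in>I. (\<Sum>n\<in>G i. norm (x n)) powr p) powr (1 / p)) \<le> baernstein_norm p x"
proof (cases "I = {}")
  case False
  obtain h where h: "bij_betw h {..<card I} I" "strict_mono_on {..<card I} h"
    using ex_bij_betw_strict_mono_card[OF I] by blast
  define F where "F j = G (h (j - 1))" for j
  have hI: "h j \<in> I" if "j < card I" for j
    using h(1) that by (auto simp: bij_betw_def)
  have mem: "F j \<in> schreier_sets - {{}}" if "j \<in> {1..card I}" for j
    unfolding F_def using that by (intro G hI) auto
  have "schreier_chain (card I) F"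
    unfolding schreier_chain_def
  proof (intro conjI ballI allI impI mem)
    fix j assume j: "1 \<le> j \<and> j < card I"
    then have "F j \<in> schreier_sets - {{}}" "F (j + 1) \<in> schreier_sets - {{}}"
      using mem[of j] mem[of "j + 1"] by simp_all
    then have "Max (F j) \<in> F j" "Min (F (j + 1)) \<in> F (j + 1)"
      by (auto simp: schreier_sets_iff)
    moreover have "h (j - 1) < h j"
      using j by (intro strict_mono_onD[OF h(2)]) auto
    moreover have "h (j - 1) \<in> I" "h j \<in> I"
      using j by (auto intro!: hI)
    ultimately show "Max (F j) < Min (F (j + 1))"
      using less[of "h (j - 1)" "h j" "Max (F j)" "Min (F (j + 1))"] by (simp add: F_def)
  qed
  moreover have "(\<Sum>j=1..card I. (\<Sum>n\<in>F j. norm (x n)) powr p) = (\<Sum>i\<in>I. (\<Sum>n\<in>G i. norm (x n)) powr p)"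
  proof -
    have "(\<Sum>j=1..card I. (\<Sum>n\<in>F j. norm (x n)) powr p)
        = (\<Sum>j\<in>{..<card I}. (\<Sum>n\<in>G (h j). norm (x n)) powr p)"
      by (rule sum.reindex_bij_witness[of _ Suc "\<lambda>j. j - 1"]) (auto simp: F_def)
    also have "\<dots> = (\<Sum>i\<in>I. (\<Sum>n\<in>G i. norm (x n)) powr p)"
      by (rule sum.reindex_bij_betw[OF h(1)])
    finally show ?thesis .
  qed
  moreover have "1 \<le> card I"
    using I False by (simp add: Suc_le_eq card_gt_0_iff)
  ultimately show ?thesis
    unfolding baernstein_norm_def by (intro SUP_upper2[of "(card I, F)"]) auto
qed simp

lemma baernstein_norm_transfer:
  fixes x y :: "nat \<Rightarrow> 'k::{real_normed_field, euclidean_space}"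
  assumes p: "1 < p" and M: "infinite M" "M \<subseteq> {1..}" and N: "infinite N"
    and K: "\<And>J. finite J \<Longrightarrow> enumerate N ` J \<in> schreier_sets \<Longrightarrow>
              schreier_covering_number (enumerate M ` J) \<le> K"
    and y: "\<And>j. y (enumerate N j) = x (enumerate M j)" "\<And>n. n \<notin> N \<Longrightarrow> y n = 0"
  shows "baernstein_norm p y \<le> ennreal K * baernstein_norm p x"
  unfolding baernstein_norm_def[of p y]
proof (rule SUP_least, clarify)
  fix m F assume F: "schreier_chain m F"
  let ?g = "\<lambda>n. norm (y n)" and ?f = "\<lambda>n. norm (x n)"
  define I where "I = {i \<in> {1..m}. F i \<inter> N \<noteq> {}}"
  have FS: "F i \<in> schreier_sets" if "i \<in> {1..m}" for i
    using F that by (auto simp: schreier_chain_def)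
  have "\<exists>G. G \<in> schreier_sets - {{}} \<and> G \<subseteq> enumerate M ` {j. enumerate N j \<in> F i} \<and>
      sum ?g (F i) \<le> real K * sum ?f G" if "i \<in> I" for i
    using schreier_set_transfer[OF M N K, of ?f ?g "F i"] y that FS by (auto simp: I_def)
  then obtain G where G: "\<And>i. i \<in> I \<Longrightarrow> G i \<in> schreier_sets - {{}}"
      "\<And>i. i \<in> I \<Longrightarrow> G i \<subseteq> enumerate M ` {j. enumerate N j \<in> F i}"
      "\<And>i. i \<in> I \<Longrightarrow> sum ?g (F i) \<le> real K * sum ?f (G i)"
    by metis
  have less: "a < b" if ij: "i \<in> I" "j \<in> I" "i < j" and ab: "a \<in> G i" "b \<in> G j" for i j a b
  proof -
    obtain s t where st: "a = enumerate M s" "enumerate N s \<in> F i" "b = enumerate M t" "enumerate N t \<in> F j"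
      using G(2)[OF ij(1)] G(2)[OF ij(2)] ab by blast
    have ij': "i \<in> {1..m}" "j \<in> {1..m}"
      using ij by (auto simp: I_def)
    have "enumerate N s \<le> Max (F i)" "Min (F j) \<le> enumerate N t"
      using st FS[OF ij'(1)] FS[OF ij'(2)] by (auto simp: schreier_sets_iff)
    moreover have "Max (F i) < Min (F j)"
      using schreier_chain_less[OF F ij(3)] ij' by simp
    ultimately have "enumerate N s < enumerate N t"
      by simp
    then show ?thesis
      using M N by (simp add: st)
  qed
  have "(\<Sum>j=1..m. sum ?g (F j) powr p) = (\<Sum>j\<in>I. sum ?g (F j) powr p)"
  proof (rule sum.mono_neutral_right)
    show "\<forall>j\<in>{1..m} - I. sum ?g (F j) powr p = 0"
    proof
      fix j assume "j \<in> {1..m} - I"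
      then have "\<forall>n\<in>F j. ?g n = 0"
        using y(2) by (auto simp: I_def)
      then show "sum ?g (F j) powr p = 0"
        by simp
    qed
  qed (auto simp: I_def)
  also have "\<dots> \<le> (\<Sum>j\<in>I. (real K * sum ?f (G j)) powr p)"
    using p G(3) by (intro sum_mono powr_mono2) (auto intro: sum_nonneg)
  also have "\<dots> = real K powr p * (\<Sum>j\<in>I. sum ?f (G j) powr p)"
    unfolding powr_mult by (rule sum_distrib_left[symmetric])
  finally have "ennreal ((\<Sum>j=1..m. sum ?g (F j) powr p) powr (1 / p))
      \<le> ennreal ((real K powr p * (\<Sum>j\<in>I. sum ?f (G j) powr p)) powr (1 / p))"
    using p by (intro ennreal_powr_mono) (auto intro: sum_nonneg)
  also have "\<dots> = ennreal K * ennreal ((\<Sum>j\<in>I. sum ?f (G j) powr p) powr (1 / p))"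
    using p by (simp add: powr_mult powr_powr sum_nonneg ennreal_mult)
  also have "\<dots> \<le> ennreal K * baernstein_norm p x"
    using G(1) less by (intro mult_left_mono baernstein_norm_ge) (auto simp: I_def)
  finally show "ennreal ((\<Sum>j=1..m. sum ?g (F j) powr p) powr (1 / p)) \<le> ennreal K * baernstein_norm p x" .
qed

section \<open>The equivalence\<close>

text \<open>The shift between index sets in the positive integers and enumerations that start at 0.\<close>
lemma gasparis_leung_index_finite_iff:
  "gasparis_leung_index M N \<noteq> \<infinity> \<longleftrightarrow>
     (\<exists>C. \<forall>J. finite J \<longrightarrow> enumerate N ` J \<in> schreier_sets \<longrightarrow>
        schreier_covering_number (enumerate M ` J) \<le> C)" (is "_ \<longleftrightarrow> (\<exists>C. ?P C)")
proof -
  let ?J = "{J. finite J \<and> J \<subseteq> {1..} \<and> nth_element N ` J \<in> schreier_sets}"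
  have shift: "nth_element L ` Suc ` J = enumerate L ` J" for L J
    by (simp add: image_image nth_element_def)
  have bound: "gasparis_leung_index M N \<le> enat C \<longleftrightarrow> ?P C" for C
  proof
    assume le: "gasparis_leung_index M N \<le> enat C"
    show "?P C"
    proof (intro allI impI)
      fix J :: "nat set" assume J: "finite J" "enumerate N ` J \<in> schreier_sets"
      then have "Suc ` J \<in> ?J"
        by (auto simp: shift)
      then have "enat (schreier_covering_number (nth_element M ` Suc ` J)) \<le> gasparis_leung_index M N"
        unfolding gasparis_leung_index_def by (rule SUP_upper)
      then show "schreier_covering_number (enumerate M ` J) \<le> C"
        using le unfolding shift by (metis enat_ord_simps(1) order_trans)
    qed
  next
    assume P: "?P C"
    show "gasparis_leung_index M N \<le> enat C"
      unfolding gasparis_leung_index_def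
    proof (rule SUP_least)
      fix J assume J: "J \<in> ?J"
      then have "J = Suc ` (\<lambda>j. j - 1) ` J"
        by (force simp: image_image)
      then obtain J' where "J = Suc ` J'" "finite J'"
        using J by blast
      then show "enat (schreier_covering_number (nth_element M ` J)) \<le> enat C"
        using J P by (auto simp: shift)
    qed
  qed
  have "gasparis_leung_index M N \<noteq> \<infinity> \<longleftrightarrow> (\<exists>C. gasparis_leung_index M N \<le> enat C)"
    by (metis enat_ord_simps(5) infinity_ileE not_infinity_eq order_refl)
  then show ?thesis
    by (simp only: bound)
qed

text \<open>
  The two linear combinations in the definition of domination have the same coordinates along \<open>M\<close> and \<open>N\<close>.
\<close>
lemma dominates_of_transfer:
  fixes nrm :: "(nat \<Rightarrow> 'k::{real_normed_field, euclidean_space}) \<Rightarrow> ennreal"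
  assumes M: "infinite M" and N: "infinite N" and K: "0 < K"
    and le: "\<And>x y. (\<And>j. y (enumerate N j) = x (enumerate M j)) \<Longrightarrow> (\<And>n. n \<notin> N \<Longrightarrow> y n = 0) \<Longrightarrow>
              nrm y \<le> ennreal K * nrm x"
  shows "dominates nrm (\<lambda>n. unit_vector (nth_element M n)) nrm (\<lambda>n. unit_vector (nth_element N n))"
  unfolding dominates_def
proof (intro exI[of _ K] conjI allI impI K le)
  fix r :: nat and \<alpha> :: "nat \<Rightarrow> 'k"
  have sum: "(\<Sum>n=1..r. \<alpha> n *\<^sub>s unit_vector (nth_element L n)) k
      = (\<Sum>n=1..r. if nth_element L n = k then \<alpha> n else 0)" for L k
  proof -
    have "(\<Sum>n\<in>A. \<alpha> n *\<^sub>s unit_vector (nth_element L n)) k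
        = (\<Sum>n\<in>A. if nth_element L n = k then \<alpha> n else 0)" if "finite A" for A
      using that by (induction rule: finite_induct) (auto simp: seq_scale_def unit_vector_def)
    then show ?thesis
      by blast
  qed
  have eq: "nth_element L n = enumerate L j \<longleftrightarrow> n - 1 = j" if "infinite L" for L n j
    using inj_enumerate[OF that] by (simp add: nth_element_def inj_eq)
  show "(\<Sum>n=1..r. \<alpha> n *\<^sub>s unit_vector (nth_element N n)) (enumerate N j)
      = (\<Sum>n=1..r. \<alpha> n *\<^sub>s unit_vector (nth_element M n)) (enumerate M j)" for j
    unfolding sum eq[OF M] eq[OF N] ..
  show "(\<Sum>n=1..r. \<alpha> n *\<^sub>s unit_vector (nth_element N n)) k = 0" if "k \<notin> N" for k
    unfolding sum using that enumerate_in_set[OF N] by (intro sum.neutral) (auto simp: nth_element_def)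
qed

theorem theorem4p1:
  fixes nrm :: "(nat \<Rightarrow> 'k::{real_normed_field, euclidean_space}) \<Rightarrow> ennreal"
    and p :: real
    and M N :: "nat set"
  assumes E: "(1 < p \<and> nrm = baernstein_norm p) \<or> (1 \<le> p \<and> nrm = schreier_norm p)"
    and M: "infinite M" "M \<subseteq> {1..}"
    and N: "infinite N" "N \<subseteq> {1..}"
  shows "(gasparis_leung_index M N \<noteq> \<infinity> \<longleftrightarrow>
            dominates nrm (\<lambda>n. unit_vector (nth_element M n)) nrm (\<lambda>n. unit_vector (nth_element N n)))
       \<and> (dominates nrm (\<lambda>n. unit_vector (nth_element M n)) nrm (\<lambda>n. unit_vector (nth_element N n)) \<longleftrightarrow>
            (\<exists>T\<in>bounded_operators nrm (closed_span nrm M) (closed_span nrm N).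
               (INF m\<in>M. sup_norm (T (unit_vector m))) > 0))"
    (is "(?a \<longleftrightarrow> ?b) \<and> (_ \<longleftrightarrow> ?c)")
proof -
  obtain q \<theta> where "schreier_type_norm nrm q \<theta>"
    using E schreier_type_norm_baernstein_norm schreier_type_norm_schreier_norm by blast
  then interpret schreier_type_norm nrm q \<theta> .
  have ab: ?b if a: ?a
  proof -
    obtain K0 where K0: "\<And>J. finite J \<Longrightarrow> enumerate N ` J \<in> schreier_sets \<Longrightarrow>
        schreier_covering_number (enumerate M ` J) \<le> K0"
      using a unfolding gasparis_leung_index_finite_iff by blast
    define K where "K = Suc K0"
    have K: "1 \<le> K" "\<And>J. finite J \<Longrightarrow> enumerate N ` J \<in> schreier_sets \<Longrightarrow>
        schreier_covering_number (enumerate M ` J) \<le> K"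
      using K0 by (auto simp: K_def le_SucI)
    have "nrm y \<le> ennreal K * nrm x"
      if xy: "\<And>j. y (enumerate N j) = x (enumerate M j)" "\<And>n. n \<notin> N \<Longrightarrow> y n = 0" for x y
      using E
    proof (elim disjE conjE)
      assume "1 < p" "nrm = baernstein_norm p"
      then show ?thesis
        using baernstein_norm_transfer[of p M N K y x] M N(1) K(2) xy by blast
    next
      assume "1 \<le> p" "nrm = schreier_norm p"
      then show ?thesis
        using schreier_norm_transfer[of p M N K y x] M N(1) K xy by blast
    qed
    then show ?b
      using K(1) by (intro dominates_of_transfer[OF M(1) N(1), of "real K"]) auto
  qed
  have bc: ?c if ?b
    using operator_of_domination[OF M N that] .
  have ca: ?a if ?c
    using that covering_numbers_bounded_of_operator[OF M N] unfolding gasparis_leung_index_finite_iff by blast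
  show ?thesis
    using ab bc ca by blast
qed

end
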